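(* $\mathsf{QF}$-$\mathsf{CE}$ implies $\mathsf{ACA}_0$ over $\mathsf{RCA}_0$.
   Context: A formula $\varphi(X)$ of second-order arithmetic with one free set variable is of finite character if $\varphi(\emptyset)$ holds and, for every set $A$, $\varphi(A)$ holds iff $\varphi(F)$ holds for every finite $F \subseteq A$. A finitary closure operator is a set $D$ of pairs $\langle F, n\rangle$ where $F$ is (the canonical index of) a finite, possibly empty, subset of $\mathbb{N}$ and $n \in \mathbb{N}$; a set $A \subseteq \mathbb{N}$ is $D$-closed if for every $\langle F,n\rangle \in D$ with $F \subseteq A$ we have $n \in A$. $\mathsf{QF}$-$\mathsf{CE}$ is the scheme: if $D$ is a finitary closure operator, $\varphi$ is a quantifier-free formula (without parameters) of finite character, and $A$ is any set, then every $D$-closed subset of $A$ satisfying $\varphi$ is contained in a $\subseteq$-maximal $D$-closed subset of $A$ satisfying $\varphi$. *)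

theory Defs
  imports Main
begin

section \<open>Second-order arithmetic\<close>

text \<open>
  The two-sorted language of second-order arithmetic. Number variables and set variables are
  both named by strings; the same string may serve as a number variable and as a set variable,
  and the two are unrelated. Equality is primitive for numbers only.
\<close>

type_synonym name = string

datatype tm =
    Var name
  | Zero ("\<^bold>0")
  | One ("\<^bold>1")
  | Add tm tm (infixl "\<^bold>+" 65)
  | Mul tm tm (infixl "\<^bold>*" 70)

datatype fm =
    Eq tm tm (infix "\<^bold>=" 50)
  | Less tm tm (infix "\<^bold><" 50)
  | Mem tm name (infix "\<^bold>\<in>" 50)
  | Neg fm ("\<^bold>\<not> _" [40] 40)
  | And fm fm (infixr "\<^bold>\<and>" 35)
  | Or fm fm (infixr "\<^bold>\<or>" 30)
  | Imp fm fm (infixr "\<^bold>\<rightarrow>" 25)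
  | Iff fm fm (infixr "\<^bold>\<leftrightarrow>" 25)
  | AllN name fm ("\<^bold>\<forall>N _./ _" [1000, 10] 10)
  | ExN name fm ("\<^bold>\<exists>N _./ _" [1000, 10] 10)
  | AllS name fm ("\<^bold>\<forall>S _./ _" [1000, 10] 10)
  | ExS name fm ("\<^bold>\<exists>S _./ _" [1000, 10] 10)

subsection \<open>Structures and satisfaction\<close>

text \<open>
  The numbers of a structure are all elements of the type \<open>'a\<close>, so the first-order part may be
  nonstandard; the set quantifiers range over \<open>set_part M\<close> only.
\<close>

record 'a l2_structure =
  zero_of :: 'a
  one_of :: 'a
  add_of :: "'a \<Rightarrow> 'a \<Rightarrow> 'a"
  mul_of :: "'a \<Rightarrow> 'a \<Rightarrow> 'a"
  less_of :: "'a \<Rightarrow> 'a \<Rightarrow> bool"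
  set_part :: "'a set set"

primrec tm_val :: "'a l2_structure \<Rightarrow> (name \<Rightarrow> 'a) \<Rightarrow> tm \<Rightarrow> 'a" where
  "tm_val M e (Var x) = e x"
| "tm_val M e \<^bold>0 = zero_of M"
| "tm_val M e \<^bold>1 = one_of M"
| "tm_val M e (s \<^bold>+ t) = add_of M (tm_val M e s) (tm_val M e t)"
| "tm_val M e (s \<^bold>* t) = mul_of M (tm_val M e s) (tm_val M e t)"

primrec sat :: "'a l2_structure \<Rightarrow> (name \<Rightarrow> 'a) \<Rightarrow> (name \<Rightarrow> 'a set) \<Rightarrow> fm \<Rightarrow> bool" where
  "sat M e E (s \<^bold>= t) \<longleftrightarrow> tm_val M e s = tm_val M e t"
| "sat M e E (s \<^bold>< t) \<longleftrightarrow> less_of M (tm_val M e s) (tm_val M e t)"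
| "sat M e E (t \<^bold>\<in> X) \<longleftrightarrow> tm_val M e t \<in> E X"
| "sat M e E (\<^bold>\<not> \<phi>) \<longleftrightarrow> \<not> sat M e E \<phi>"
| "sat M e E (\<phi> \<^bold>\<and> \<psi>) \<longleftrightarrow> sat M e E \<phi> \<and> sat M e E \<psi>"
| "sat M e E (\<phi> \<^bold>\<or> \<psi>) \<longleftrightarrow> sat M e E \<phi> \<or> sat M e E \<psi>"
| "sat M e E (\<phi> \<^bold>\<rightarrow> \<psi>) \<longleftrightarrow> (sat M e E \<phi> \<longrightarrow> sat M e E \<psi>)"
| "sat M e E (\<phi> \<^bold>\<leftrightarrow> \<psi>) \<longleftrightarrow> (sat M e E \<phi> \<longleftrightarrow> sat M e E \<psi>)"
| "sat M e E (\<^bold>\<forall>N x. \<phi>) \<longleftrightarrow> (\<forall>a. sat M (e(x := a)) E \<phi>)"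
| "sat M e E (\<^bold>\<exists>N x. \<phi>) \<longleftrightarrow> (\<exists>a. sat M (e(x := a)) E \<phi>)"
| "sat M e E (\<^bold>\<forall>S X. \<phi>) \<longleftrightarrow> (\<forall>A\<in>set_part M. sat M e (E(X := A)) \<phi>)"
| "sat M e E (\<^bold>\<exists>S X. \<phi>) \<longleftrightarrow> (\<exists>A\<in>set_part M. sat M e (E(X := A)) \<phi>)"

text \<open>A formula is true in a structure if its universal closure is.\<close>

definition models :: "'a l2_structure \<Rightarrow> fm set \<Rightarrow> bool" (infix "\<Turnstile>" 50) where
  "M \<Turnstile> T \<longleftrightarrow> (\<forall>\<phi>\<in>T. \<forall>e E. range E \<subseteq> set_part M \<longrightarrow> sat M e E \<phi>)"

subsection \<open>Free variables and substitution\<close>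

primrec tm_vars :: "tm \<Rightarrow> name set" where
  "tm_vars (Var x) = {x}"
| "tm_vars \<^bold>0 = {}"
| "tm_vars \<^bold>1 = {}"
| "tm_vars (s \<^bold>+ t) = tm_vars s \<union> tm_vars t"
| "tm_vars (s \<^bold>* t) = tm_vars s \<union> tm_vars t"

primrec free_num :: "fm \<Rightarrow> name set" where
  "free_num (s \<^bold>= t) = tm_vars s \<union> tm_vars t"
| "free_num (s \<^bold>< t) = tm_vars s \<union> tm_vars t"
| "free_num (t \<^bold>\<in> X) = tm_vars t"
| "free_num (\<^bold>\<not> \<phi>) = free_num \<phi>"
| "free_num (\<phi> \<^bold>\<and> \<psi>) = free_num \<phi> \<union> free_num \<psi>"
| "free_num (\<phi> \<^bold>\<or> \<psi>) = free_num \<phi> \<union> free_num \<psi>"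
| "free_num (\<phi> \<^bold>\<rightarrow> \<psi>) = free_num \<phi> \<union> free_num \<psi>"
| "free_num (\<phi> \<^bold>\<leftrightarrow> \<psi>) = free_num \<phi> \<union> free_num \<psi>"
| "free_num (\<^bold>\<forall>N x. \<phi>) = free_num \<phi> - {x}"
| "free_num (\<^bold>\<exists>N x. \<phi>) = free_num \<phi> - {x}"
| "free_num (\<^bold>\<forall>S X. \<phi>) = free_num \<phi>"
| "free_num (\<^bold>\<exists>S X. \<phi>) = free_num \<phi>"

primrec free_set :: "fm \<Rightarrow> name set" where
  "free_set (s \<^bold>= t) = {}"
| "free_set (s \<^bold>< t) = {}"
| "free_set (t \<^bold>\<in> X) = {X}"
| "free_set (\<^bold>\<not> \<phi>) = free_set \<phi>"
| "free_set (\<phi> \<^bold>\<and> \<psi>) = free_set \<phi> \<union> free_set \<psi>"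
| "free_set (\<phi> \<^bold>\<or> \<psi>) = free_set \<phi> \<union> free_set \<psi>"
| "free_set (\<phi> \<^bold>\<rightarrow> \<psi>) = free_set \<phi> \<union> free_set \<psi>"
| "free_set (\<phi> \<^bold>\<leftrightarrow> \<psi>) = free_set \<phi> \<union> free_set \<psi>"
| "free_set (\<^bold>\<forall>N x. \<phi>) = free_set \<phi>"
| "free_set (\<^bold>\<exists>N x. \<phi>) = free_set \<phi>"
| "free_set (\<^bold>\<forall>S X. \<phi>) = free_set \<phi> - {X}"
| "free_set (\<^bold>\<exists>S X. \<phi>) = free_set \<phi> - {X}"

primrec tm_subst :: "name \<Rightarrow> tm \<Rightarrow> tm \<Rightarrow> tm" where
  "tm_subst x t (Var y) = (if y = x then t else Var y)"
| "tm_subst x t \<^bold>0 = \<^bold>0"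
| "tm_subst x t \<^bold>1 = \<^bold>1"
| "tm_subst x t (r \<^bold>+ s) = tm_subst x t r \<^bold>+ tm_subst x t s"
| "tm_subst x t (r \<^bold>* s) = tm_subst x t r \<^bold>* tm_subst x t s"

text \<open>
  Substitution of a term for the free occurrences of a number variable \<open>x\<close>. Bound variables are
  not renamed. This is correct whenever \<open>x\<close> is the only variable that may occur in the term,
  since no free occurrence of \<open>x\<close> lies in the scope of a quantifier binding \<open>x\<close>; the induction
  axioms only substitute \<open>0\<close> and \<open>x + 1\<close> for \<open>x\<close>.
\<close>

primrec subst_num :: "name \<Rightarrow> tm \<Rightarrow> fm \<Rightarrow> fm" where
  "subst_num x t (r \<^bold>= s) = (tm_subst x t r \<^bold>= tm_subst x t s)"
| "subst_num x t (r \<^bold>< s) = (tm_subst x t r \<^bold>< tm_subst x t s)"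
| "subst_num x t (r \<^bold>\<in> X) = (tm_subst x t r \<^bold>\<in> X)"
| "subst_num x t (\<^bold>\<not> \<phi>) = (\<^bold>\<not> subst_num x t \<phi>)"
| "subst_num x t (\<phi> \<^bold>\<and> \<psi>) = (subst_num x t \<phi> \<^bold>\<and> subst_num x t \<psi>)"
| "subst_num x t (\<phi> \<^bold>\<or> \<psi>) = (subst_num x t \<phi> \<^bold>\<or> subst_num x t \<psi>)"
| "subst_num x t (\<phi> \<^bold>\<rightarrow> \<psi>) = (subst_num x t \<phi> \<^bold>\<rightarrow> subst_num x t \<psi>)"
| "subst_num x t (\<phi> \<^bold>\<leftrightarrow> \<psi>) = (subst_num x t \<phi> \<^bold>\<leftrightarrow> subst_num x t \<psi>)"
| "subst_num x t (\<^bold>\<forall>N y. \<phi>) = (\<^bold>\<forall>N y. if y = x then \<phi> else subst_num x t \<phi>)"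
| "subst_num x t (\<^bold>\<exists>N y. \<phi>) = (\<^bold>\<exists>N y. if y = x then \<phi> else subst_num x t \<phi>)"
| "subst_num x t (\<^bold>\<forall>S X. \<phi>) = (\<^bold>\<forall>S X. subst_num x t \<phi>)"
| "subst_num x t (\<^bold>\<exists>S X. \<phi>) = (\<^bold>\<exists>S X. subst_num x t \<phi>)"

text \<open>
  Replacement of the free occurrences of the set variable \<open>X\<close> by \<open>Y\<close>, again without renaming of
  bound variables. It is only applied to quantifier-free formulas.
\<close>

primrec subst_set :: "name \<Rightarrow> name \<Rightarrow> fm \<Rightarrow> fm" where
  "subst_set X Y (r \<^bold>= s) = (r \<^bold>= s)"
| "subst_set X Y (r \<^bold>< s) = (r \<^bold>< s)"
| "subst_set X Y (r \<^bold>\<in> Z) = (r \<^bold>\<in> (if Z = X then Y else Z))"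
| "subst_set X Y (\<^bold>\<not> \<phi>) = (\<^bold>\<not> subst_set X Y \<phi>)"
| "subst_set X Y (\<phi> \<^bold>\<and> \<psi>) = (subst_set X Y \<phi> \<^bold>\<and> subst_set X Y \<psi>)"
| "subst_set X Y (\<phi> \<^bold>\<or> \<psi>) = (subst_set X Y \<phi> \<^bold>\<or> subst_set X Y \<psi>)"
| "subst_set X Y (\<phi> \<^bold>\<rightarrow> \<psi>) = (subst_set X Y \<phi> \<^bold>\<rightarrow> subst_set X Y \<psi>)"
| "subst_set X Y (\<phi> \<^bold>\<leftrightarrow> \<psi>) = (subst_set X Y \<phi> \<^bold>\<leftrightarrow> subst_set X Y \<psi>)"
| "subst_set X Y (\<^bold>\<forall>N x. \<phi>) = (\<^bold>\<forall>N x. subst_set X Y \<phi>)"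
| "subst_set X Y (\<^bold>\<exists>N x. \<phi>) = (\<^bold>\<exists>N x. subst_set X Y \<phi>)"
| "subst_set X Y (\<^bold>\<forall>S Z. \<phi>) = (\<^bold>\<forall>S Z. if Z = X then \<phi> else subst_set X Y \<phi>)"
| "subst_set X Y (\<^bold>\<exists>S Z. \<phi>) = (\<^bold>\<exists>S Z. if Z = X then \<phi> else subst_set X Y \<phi>)"

subsection \<open>Classes of formulas\<close>

text \<open>Set variables may occur free, as parameters, in formulas of each of these classes.\<close>

inductive quantifier_free :: "fm \<Rightarrow> bool" where
  "quantifier_free (s \<^bold>= t)"
| "quantifier_free (s \<^bold>< t)"
| "quantifier_free (t \<^bold>\<in> X)"
| "quantifier_free \<phi> \<Longrightarrow> quantifier_free (\<^bold>\<not> \<phi>)"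
| "quantifier_free \<phi> \<Longrightarrow> quantifier_free \<psi> \<Longrightarrow> quantifier_free (\<phi> \<^bold>\<and> \<psi>)"
| "quantifier_free \<phi> \<Longrightarrow> quantifier_free \<psi> \<Longrightarrow> quantifier_free (\<phi> \<^bold>\<or> \<psi>)"
| "quantifier_free \<phi> \<Longrightarrow> quantifier_free \<psi> \<Longrightarrow> quantifier_free (\<phi> \<^bold>\<rightarrow> \<psi>)"
| "quantifier_free \<phi> \<Longrightarrow> quantifier_free \<psi> \<Longrightarrow> quantifier_free (\<phi> \<^bold>\<leftrightarrow> \<psi>)"

inductive bounded :: "fm \<Rightarrow> bool" where
  "bounded (s \<^bold>= t)"
| "bounded (s \<^bold>< t)"
| "bounded (t \<^bold>\<in> X)"
| "bounded \<phi> \<Longrightarrow> bounded (\<^bold>\<not> \<phi>)"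
| "bounded \<phi> \<Longrightarrow> bounded \<psi> \<Longrightarrow> bounded (\<phi> \<^bold>\<and> \<psi>)"
| "bounded \<phi> \<Longrightarrow> bounded \<psi> \<Longrightarrow> bounded (\<phi> \<^bold>\<or> \<psi>)"
| "bounded \<phi> \<Longrightarrow> bounded \<psi> \<Longrightarrow> bounded (\<phi> \<^bold>\<rightarrow> \<psi>)"
| "bounded \<phi> \<Longrightarrow> bounded \<psi> \<Longrightarrow> bounded (\<phi> \<^bold>\<leftrightarrow> \<psi>)"
| "bounded \<phi> \<Longrightarrow> x \<notin> tm_vars t \<Longrightarrow> bounded (\<^bold>\<forall>N x. Var x \<^bold>< t \<^bold>\<rightarrow> \<phi>)"
| "bounded \<phi> \<Longrightarrow> x \<notin> tm_vars t \<Longrightarrow> bounded (\<^bold>\<exists>N x. Var x \<^bold>< t \<^bold>\<and> \<phi>)"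

inductive sigma01 :: "fm \<Rightarrow> bool" where
  "bounded \<theta> \<Longrightarrow> sigma01 (\<^bold>\<exists>N x. \<theta>)"

inductive pi01 :: "fm \<Rightarrow> bool" where
  "bounded \<theta> \<Longrightarrow> pi01 (\<^bold>\<forall>N x. \<theta>)"

inductive arithmetical :: "fm \<Rightarrow> bool" where
  "arithmetical (s \<^bold>= t)"
| "arithmetical (s \<^bold>< t)"
| "arithmetical (t \<^bold>\<in> X)"
| "arithmetical \<phi> \<Longrightarrow> arithmetical (\<^bold>\<not> \<phi>)"
| "arithmetical \<phi> \<Longrightarrow> arithmetical \<psi> \<Longrightarrow> arithmetical (\<phi> \<^bold>\<and> \<psi>)"
| "arithmetical \<phi> \<Longrightarrow> arithmetical \<psi> \<Longrightarrow> arithmetical (\<phi> \<^bold>\<or> \<psi>)"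
| "arithmetical \<phi> \<Longrightarrow> arithmetical \<psi> \<Longrightarrow> arithmetical (\<phi> \<^bold>\<rightarrow> \<psi>)"
| "arithmetical \<phi> \<Longrightarrow> arithmetical \<psi> \<Longrightarrow> arithmetical (\<phi> \<^bold>\<leftrightarrow> \<psi>)"
| "arithmetical \<phi> \<Longrightarrow> arithmetical (\<^bold>\<forall>N x. \<phi>)"
| "arithmetical \<phi> \<Longrightarrow> arithmetical (\<^bold>\<exists>N x. \<phi>)"

section \<open>The systems RCA0 and ACA0\<close>

text \<open>
  The axiomatisations follow Simpson, Subsystems of Second Order Arithmetic. Free variables of
  axioms are parameters, universally quantified by the definition of \<open>(\<Turnstile>)\<close>.
\<close>

definition basic_axioms :: "fm set" where
  "basic_axioms =
    {\<^bold>\<not> Var ''n'' \<^bold>+ \<^bold>1 \<^bold>= \<^bold>0,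
     Var ''m'' \<^bold>+ \<^bold>1 \<^bold>= Var ''n'' \<^bold>+ \<^bold>1 \<^bold>\<rightarrow> Var ''m'' \<^bold>= Var ''n'',
     Var ''m'' \<^bold>+ \<^bold>0 \<^bold>= Var ''m'',
     Var ''m'' \<^bold>+ (Var ''n'' \<^bold>+ \<^bold>1) \<^bold>= (Var ''m'' \<^bold>+ Var ''n'') \<^bold>+ \<^bold>1,
     Var ''m'' \<^bold>* \<^bold>0 \<^bold>= \<^bold>0,
     Var ''m'' \<^bold>* (Var ''n'' \<^bold>+ \<^bold>1) \<^bold>= Var ''m'' \<^bold>* Var ''n'' \<^bold>+ Var ''m'',
     \<^bold>\<not> Var ''m'' \<^bold>< \<^bold>0,
     Var ''m'' \<^bold>< Var ''n'' \<^bold>+ \<^bold>1 \<^bold>\<leftrightarrow> Var ''m'' \<^bold>< Var ''n'' \<^bold>\<or> Var ''m'' \<^bold>= Var ''n''}"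

definition induction_fm :: "name \<Rightarrow> fm \<Rightarrow> fm" where
  "induction_fm x \<phi> =
    (subst_num x \<^bold>0 \<phi> \<^bold>\<and> (\<^bold>\<forall>N x. \<phi> \<^bold>\<rightarrow> subst_num x (Var x \<^bold>+ \<^bold>1) \<phi>) \<^bold>\<rightarrow> (\<^bold>\<forall>N x. \<phi>))"

definition comprehension_fm :: "name \<Rightarrow> name \<Rightarrow> fm \<Rightarrow> fm" where
  "comprehension_fm X x \<phi> = (\<^bold>\<exists>S X. \<^bold>\<forall>N x. Var x \<^bold>\<in> X \<^bold>\<leftrightarrow> \<phi>)"

definition RCA0 :: "fm set" where
  "RCA0 = basic_axioms
    \<union> {induction_fm x \<phi> | x \<phi>. sigma01 \<phi>}
    \<union> {(\<^bold>\<forall>N x. \<phi> \<^bold>\<leftrightarrow> \<psi>) \<^bold>\<rightarrow> comprehension_fm X x \<phi> | X x \<phi> \<psi>.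
        sigma01 \<phi> \<and> pi01 \<psi> \<and> X \<notin> free_set \<phi>}"

definition ACA0 :: "fm set" where
  "ACA0 = basic_axioms
    \<union> {induction_fm ''n'' (Var ''n'' \<^bold>\<in> ''X'')}
    \<union> {comprehension_fm X x \<phi> | X x \<phi>. arithmetical \<phi> \<and> X \<notin> free_set \<phi>}"

section \<open>The closure extension scheme\<close>

text \<open>
  The bound variables of the formulas below have fixed names. To avoid capture, a variable passed
  as an argument must differ from the bound variables of its sort in whose scope it is placed;
  this holds for all uses in \<open>CE_fm\<close>.
\<close>

definition pair_tm :: "tm \<Rightarrow> tm \<Rightarrow> tm" where
  "pair_tm s t = (s \<^bold>+ t) \<^bold>* (s \<^bold>+ t) \<^bold>+ s"

definition subset_fm :: "name \<Rightarrow> name \<Rightarrow> fm" where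
  "subset_fm X Y = (\<^bold>\<forall>N ''i''. Var ''i'' \<^bold>\<in> X \<^bold>\<rightarrow> Var ''i'' \<^bold>\<in> Y)"

definition seteq_fm :: "name \<Rightarrow> name \<Rightarrow> fm" where
  "seteq_fm X Y = (\<^bold>\<forall>N ''i''. Var ''i'' \<^bold>\<in> X \<^bold>\<leftrightarrow> Var ''i'' \<^bold>\<in> Y)"

definition empty_fm :: "name \<Rightarrow> fm" where
  "empty_fm X = (\<^bold>\<forall>N ''i''. \<^bold>\<not> Var ''i'' \<^bold>\<in> X)"

definition finite_fm :: "name \<Rightarrow> fm" where
  "finite_fm X = (\<^bold>\<exists>N ''k''. \<^bold>\<forall>N ''i''. Var ''i'' \<^bold>\<in> X \<^bold>\<rightarrow> Var ''i'' \<^bold>< Var ''k'')"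

text \<open>
  Canonical indices of finite sets as in Simpson: the index of \<open>X\<close> is the least \<open>c\<close> of the form
  \<open>(k, (m, n))\<close> such that, for all \<open>i\<close>, \<open>i \<in> X\<close> iff \<open>i < k\<close> and \<open>m (i + 1) + 1\<close> divides \<open>n\<close>.
\<close>

definition represents_fm :: "name \<Rightarrow> name \<Rightarrow> fm" where
  "represents_fm c X =
    (\<^bold>\<exists>N ''k''. \<^bold>\<exists>N ''m''. \<^bold>\<exists>N ''n''.
       Var c \<^bold>= pair_tm (Var ''k'') (pair_tm (Var ''m'') (Var ''n'')) \<^bold>\<and>
       (\<^bold>\<forall>N ''i''. Var ''i'' \<^bold>\<in> X \<^bold>\<leftrightarrow>
          Var ''i'' \<^bold>< Var ''k'' \<^bold>\<and>
          (\<^bold>\<exists>N ''q''. Var ''n'' \<^bold>= Var ''q'' \<^bold>* (Var ''m'' \<^bold>* (Var ''i'' \<^bold>+ \<^bold>1) \<^bold>+ \<^bold>1))))"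

definition index_fm :: "name \<Rightarrow> name \<Rightarrow> fm" where
  "index_fm c X =
    (represents_fm c X \<^bold>\<and> (\<^bold>\<forall>N ''d''. Var ''d'' \<^bold>< Var c \<^bold>\<rightarrow> \<^bold>\<not> represents_fm ''d'' X))"

definition closure_op_fm :: "name \<Rightarrow> fm" where
  "closure_op_fm D =
    (\<^bold>\<forall>N ''p''. Var ''p'' \<^bold>\<in> D \<^bold>\<rightarrow>
       (\<^bold>\<exists>N ''c''. \<^bold>\<exists>N ''n''. Var ''p'' \<^bold>= pair_tm (Var ''c'') (Var ''n'') \<^bold>\<and>
          (\<^bold>\<exists>S ''F''. index_fm ''c'' ''F'')))"

definition closed_fm :: "name \<Rightarrow> name \<Rightarrow> fm" where
  "closed_fm D A =
    (\<^bold>\<forall>N ''c''. \<^bold>\<forall>N ''n''. \<^bold>\<forall>S ''F''.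
       pair_tm (Var ''c'') (Var ''n'') \<^bold>\<in> D \<^bold>\<and> index_fm ''c'' ''F'' \<^bold>\<and> subset_fm ''F'' A \<^bold>\<rightarrow>
       Var ''n'' \<^bold>\<in> A)"

text \<open>In the following definitions \<open>\<phi>\<close> is a formula in the set variable \<open>X\<close>.\<close>

definition fin_char_fm :: "name \<Rightarrow> fm \<Rightarrow> fm" where
  "fin_char_fm X \<phi> =
    ((\<^bold>\<forall>S ''Z''. empty_fm ''Z'' \<^bold>\<rightarrow> subst_set X ''Z'' \<phi>) \<^bold>\<and>
     (\<^bold>\<forall>S ''A''. subst_set X ''A'' \<phi> \<^bold>\<leftrightarrow>
        (\<^bold>\<forall>S ''F''. finite_fm ''F'' \<^bold>\<and> subset_fm ''F'' ''A'' \<^bold>\<rightarrow> subst_set X ''F'' \<phi>)))"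

definition candidate_fm :: "name \<Rightarrow> name \<Rightarrow> name \<Rightarrow> fm \<Rightarrow> name \<Rightarrow> fm" where
  "candidate_fm D A X \<phi> B = (subset_fm B A \<^bold>\<and> closed_fm D B \<^bold>\<and> subst_set X B \<phi>)"

definition maximal_candidate_fm :: "name \<Rightarrow> name \<Rightarrow> name \<Rightarrow> fm \<Rightarrow> name \<Rightarrow> fm" where
  "maximal_candidate_fm D A X \<phi> C =
    (candidate_fm D A X \<phi> C \<^bold>\<and>
     (\<^bold>\<forall>S ''E''. candidate_fm D A X \<phi> ''E'' \<^bold>\<and> subset_fm C ''E'' \<^bold>\<rightarrow> seteq_fm ''E'' C))"

definition CE_fm :: "name \<Rightarrow> fm \<Rightarrow> fm" where
  "CE_fm X \<phi> =
    (\<^bold>\<forall>S ''D''. \<^bold>\<forall>S ''A''. closure_op_fm ''D'' \<^bold>\<and> fin_char_fm X \<phi> \<^bold>\<rightarrow>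
       (\<^bold>\<forall>S ''B''. candidate_fm ''D'' ''A'' X \<phi> ''B'' \<^bold>\<rightarrow>
          (\<^bold>\<exists>S ''C''. subset_fm ''B'' ''C'' \<^bold>\<and> maximal_candidate_fm ''D'' ''A'' X \<phi> ''C'')))"

definition QF_CE :: "fm set" where
  "QF_CE = {CE_fm X \<phi> | X \<phi>. quantifier_free \<phi> \<and> free_num \<phi> = {} \<and> free_set \<phi> \<subseteq> {X}}"

end

theory Submission
  imports Defs
begin

text \<open>
  It suffices to obtain projections \<open>{w. \<exists>a. (a, w) \<in> Y}\<close> of sets \<open>Y\<close>, because arithmetical
  comprehension then follows by induction on formulas, with assignments to the free variables
  coded by iterated pairs. For projections, closure extension is applied to the formula
  \<open>0 \<notin> X\<close>, which is of finite character, and to an operator under which codes of pairs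
  with the same second component \<open>w\<close> generate each other, and generate \<open>0\<close> if one of them
  belongs to \<open>Y\<close>. In a maximal closed set the codes over \<open>w\<close> are present exactly when \<open>w\<close>
  is not in the projection. Only singletons occur as premises of the operator, so the only
  indices of finite sets needed inside the (possibly nonstandard) model are those of singletons.
\<close>

section \<open>Fresh variables and substitution\<close>

lemma finite_tm_vars: "finite (tm_vars t)"
  by (induction t) auto

lemma finite_free_num: "finite (free_num \<phi>)"
  by (induction \<phi>) (auto simp: finite_tm_vars)

lemma finite_free_set: "finite (free_set \<phi>)"
  by (induction \<phi>) auto

lemma ex_fresh_name: "finite N \<Longrightarrow> \<exists>x :: name. x \<notin> N"
  by (rule ex_new_if_finite) (simp_all add: infinite_UNIV_listI)

lemma tm_val_cong: "(\<And>x. x \<in> tm_vars t \<Longrightarrow> e x = e' x) \<Longrightarrow> tm_val M e t = tm_val M e' t"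
  by (induction t) auto

lemma tm_val_fun_upd [simp]: "x \<notin> tm_vars t \<Longrightarrow> tm_val M (e(x := a)) t = tm_val M e t"
  by (rule tm_val_cong) auto

lemma sat_cong:
  assumes "\<And>x. x \<in> free_num \<phi> \<Longrightarrow> e x = e' x" and "\<And>X. X \<in> free_set \<phi> \<Longrightarrow> E X = E' X"
  shows "sat M e E \<phi> \<longleftrightarrow> sat M e' E' \<phi>"
  using assms
proof (induction \<phi> arbitrary: e e' E E')
  case (Eq s t)
  then show ?case using tm_val_cong[of s e e' M] tm_val_cong[of t e e' M] by simp
next
  case (Less s t)
  then show ?case using tm_val_cong[of s e e' M] tm_val_cong[of t e e' M] by simp
next
  case (Mem t X)
  then show ?case using tm_val_cong[of t e e' M] by simp
next
  case (Neg \<phi>)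
  then show ?case by (metis free_num.simps(4) free_set.simps(4) sat.simps(4))
next
  case (And \<phi> \<psi>)
  have "sat M e E \<phi> \<longleftrightarrow> sat M e' E' \<phi>" "sat M e E \<psi> \<longleftrightarrow> sat M e' E' \<psi>"
    by (rule And.IH; use And.prems in auto)+
  then show ?case by simp
next
  case (Or \<phi> \<psi>)
  have "sat M e E \<phi> \<longleftrightarrow> sat M e' E' \<phi>" "sat M e E \<psi> \<longleftrightarrow> sat M e' E' \<psi>"
    by (rule Or.IH; use Or.prems in auto)+
  then show ?case by simp
next
  case (Imp \<phi> \<psi>)
  have "sat M e E \<phi> \<longleftrightarrow> sat M e' E' \<phi>" "sat M e E \<psi> \<longleftrightarrow> sat M e' E' \<psi>"
    by (rule Imp.IH; use Imp.prems in auto)+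
  then show ?case by simp
next
  case (Iff \<phi> \<psi>)
  have "sat M e E \<phi> \<longleftrightarrow> sat M e' E' \<phi>" "sat M e E \<psi> \<longleftrightarrow> sat M e' E' \<psi>"
    by (rule Iff.IH; use Iff.prems in auto)+
  then show ?case by simp
next
  case (AllN x \<phi>)
  have "sat M (e(x := a)) E \<phi> \<longleftrightarrow> sat M (e'(x := a)) E' \<phi>" for a
    by (rule AllN.IH; use AllN.prems in auto)
  then show ?case by simp
next
  case (ExN x \<phi>)
  have "sat M (e(x := a)) E \<phi> \<longleftrightarrow> sat M (e'(x := a)) E' \<phi>" for a
    by (rule ExN.IH; use ExN.prems in auto)
  then show ?case by simp
next
  case (AllS X \<phi>)
  have "sat M e (E(X := A)) \<phi> \<longleftrightarrow> sat M e' (E'(X := A)) \<phi>" for A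
    by (rule AllS.IH; use AllS.prems in auto)
  then show ?case by simp
next
  case (ExS X \<phi>)
  have "sat M e (E(X := A)) \<phi> \<longleftrightarrow> sat M e' (E'(X := A)) \<phi>" for A
    by (rule ExS.IH; use ExS.prems in auto)
  then show ?case by simp
qed

lemma sat_fun_upd_num: "x \<notin> free_num \<phi> \<Longrightarrow> sat M (e(x := a)) E \<phi> \<longleftrightarrow> sat M e E \<phi>"
  by (rule sat_cong) auto

lemma sat_fun_upd_set: "X \<notin> free_set \<phi> \<Longrightarrow> sat M e (E(X := A)) \<phi> \<longleftrightarrow> sat M e E \<phi>"
  by (rule sat_cong) auto

lemma tm_val_subst: "tm_val M e (tm_subst x t s) = tm_val M (e(x := tm_val M e t)) s"
  by (induction s) auto

text \<open>As \<open>t\<close> mentions no variable except \<open>x\<close>, a quantifier over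
  another variable cannot capture it. A quantifier over \<open>x\<close> leaves its body unchanged
  and overwrites the value of \<open>x\<close>.\<close>

lemma sat_subst_num:
  "tm_vars t \<subseteq> {x} \<Longrightarrow> sat M e E (subst_num x t \<phi>) \<longleftrightarrow> sat M (e(x := tm_val M e t)) E \<phi>"
proof (induction \<phi> arbitrary: e E)
  case (AllN y \<phi>)
  show ?case
  proof (cases "y = x")
    case False
    have y: "y \<notin> tm_vars t" using AllN.prems False by auto
    have "sat M (e(y := a)) E (subst_num x t \<phi>)
        \<longleftrightarrow> sat M (e(x := tm_val M e t, y := a)) E \<phi>" for a
      by (subst AllN.IH[OF AllN.prems]) (simp only: tm_val_fun_upd[OF y] fun_upd_twist[OF False])
    with False show ?thesis by (simp only: subst_num.simps sat.simps if_False)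
  qed (simp only: subst_num.simps sat.simps if_True fun_upd_upd simp_thms)
next
  case (ExN y \<phi>)
  show ?case
  proof (cases "y = x")
    case False
    have y: "y \<notin> tm_vars t" using ExN.prems False by auto
    have "sat M (e(y := a)) E (subst_num x t \<phi>)
        \<longleftrightarrow> sat M (e(x := tm_val M e t, y := a)) E \<phi>" for a
      by (subst ExN.IH[OF ExN.prems]) (simp only: tm_val_fun_upd[OF y] fun_upd_twist[OF False])
    with False show ?thesis by (simp only: subst_num.simps sat.simps if_False)
  qed (simp only: subst_num.simps sat.simps if_True fun_upd_upd simp_thms)
qed (simp_all add: tm_val_subst)

text \<open>The successor turns the strict bound required by \<open>bounded\<close> into a weak one.
  A component can equal its pair (\<open>pair \<zero> \<zero>\<close> is \<open>\<zero>\<close>), so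
  strict bounds would lose witnesses.\<close>

definition bex :: "name \<Rightarrow> tm \<Rightarrow> fm \<Rightarrow> fm" where
  "bex x t \<phi> = (\<^bold>\<exists>N x. Var x \<^bold>< t \<^bold>+ \<^bold>1 \<^bold>\<and> \<phi>)"

lemma bounded_bex: "bounded \<phi> \<Longrightarrow> x \<notin> tm_vars t \<Longrightarrow> bounded (bex x t \<phi>)"
  unfolding bex_def by (rule bounded.intros) auto

lemmas bounded_rules = bounded.intros bounded_bex

section \<open>Arithmetic and comprehension in models of RCA0\<close>

text \<open>Truth of an axiom ranges over assignments of sets, so it carries information only if
  some set can be assigned. The case of an empty set part is settled separately in the final
  theorem.\<close>

locale rca0_model =
  fixes M :: "'a l2_structure"
  assumes models_RCA0: "M \<Turnstile> RCA0" and set_part_nonempty: "set_part M \<noteq> {}"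
begin

abbreviation zero ("\<zero>") where "\<zero> \<equiv> zero_of M"
abbreviation one ("\<one>") where "\<one> \<equiv> one_of M"
abbreviation plus (infixl "\<oplus>" 65) where "(\<oplus>) \<equiv> add_of M"
abbreviation times (infixl "\<otimes>" 70) where "(\<otimes>) \<equiv> mul_of M"
abbreviation less (infix "\<prec>" 50) where "(\<prec>) \<equiv> less_of M"
abbreviation sets where "sets \<equiv> set_part M"

section \<open>The basic axioms as facts about the model\<close>

lemma sat_RCA0: "\<phi> \<in> RCA0 \<Longrightarrow> range E \<subseteq> sets \<Longrightarrow> sat M e E \<phi>"
  using models_RCA0 unfolding models_def by blast

lemma sat_basic: "\<phi> \<in> basic_axioms \<Longrightarrow> \<exists>E. \<forall>e. sat M e E \<phi>"
proof -
  assume *: "\<phi> \<in> basic_axioms"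
  obtain A where "A \<in> sets" using set_part_nonempty by blast
  then show ?thesis using * by (intro exI[of _ "\<lambda>_. A"]) (auto intro!: sat_RCA0 simp: RCA0_def)
qed

lemma succ_neq_zero [simp]: "a \<oplus> \<one> \<noteq> \<zero>" "\<zero> \<noteq> a \<oplus> \<one>"
proof -
  obtain E where "\<forall>e. sat M e E (\<^bold>\<not> Var ''n'' \<^bold>+ \<^bold>1 \<^bold>= \<^bold>0)"
    using sat_basic[of "\<^bold>\<not> Var ''n'' \<^bold>+ \<^bold>1 \<^bold>= \<^bold>0"] by (auto simp: basic_axioms_def)
  from spec[OF this, of "\<lambda>x. a"] show "a \<oplus> \<one> \<noteq> \<zero>" "\<zero> \<noteq> a \<oplus> \<one>" by auto
qed

lemma succ_inject [simp]: "a \<oplus> \<one> = b \<oplus> \<one> \<longleftrightarrow> a = b"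
proof -
  obtain E where "\<forall>e. sat M e E (Var ''m'' \<^bold>+ \<^bold>1 \<^bold>= Var ''n'' \<^bold>+ \<^bold>1 \<^bold>\<rightarrow> Var ''m'' \<^bold>= Var ''n'')"
    using sat_basic[of "Var ''m'' \<^bold>+ \<^bold>1 \<^bold>= Var ''n'' \<^bold>+ \<^bold>1 \<^bold>\<rightarrow> Var ''m'' \<^bold>= Var ''n''"]
    by (auto simp: basic_axioms_def)
  from spec[OF this, of "\<lambda>x. if x = ''m'' then a else b"] show ?thesis by auto
qed

lemma add_zero [simp]: "a \<oplus> \<zero> = a"
proof -
  obtain E where "\<forall>e. sat M e E (Var ''m'' \<^bold>+ \<^bold>0 \<^bold>= Var ''m'')"
    using sat_basic[of "Var ''m'' \<^bold>+ \<^bold>0 \<^bold>= Var ''m''"] by (auto simp: basic_axioms_def)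
  from spec[OF this, of "\<lambda>x. a"] show ?thesis by auto
qed

lemma add_succ: "a \<oplus> (b \<oplus> \<one>) = (a \<oplus> b) \<oplus> \<one>"
proof -
  let ?\<phi> = "Var ''m'' \<^bold>+ (Var ''n'' \<^bold>+ \<^bold>1) \<^bold>= (Var ''m'' \<^bold>+ Var ''n'') \<^bold>+ \<^bold>1"
  obtain E where "\<forall>e. sat M e E ?\<phi>" using sat_basic[of ?\<phi>] by (auto simp: basic_axioms_def)
  from spec[OF this, of "\<lambda>x. if x = ''m'' then a else b"] show ?thesis by auto
qed

lemma mul_zero [simp]: "a \<otimes> \<zero> = \<zero>"
proof -
  obtain E where "\<forall>e. sat M e E (Var ''m'' \<^bold>* \<^bold>0 \<^bold>= \<^bold>0)"
    using sat_basic[of "Var ''m'' \<^bold>* \<^bold>0 \<^bold>= \<^bold>0"] by (auto simp: basic_axioms_def)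
  from spec[OF this, of "\<lambda>x. a"] show ?thesis by auto
qed

lemma mul_succ: "a \<otimes> (b \<oplus> \<one>) = a \<otimes> b \<oplus> a"
proof -
  let ?\<phi> = "Var ''m'' \<^bold>* (Var ''n'' \<^bold>+ \<^bold>1) \<^bold>= Var ''m'' \<^bold>* Var ''n'' \<^bold>+ Var ''m''"
  obtain E where "\<forall>e. sat M e E ?\<phi>" using sat_basic[of ?\<phi>] by (auto simp: basic_axioms_def)
  from spec[OF this, of "\<lambda>x. if x = ''m'' then a else b"] show ?thesis by auto
qed

lemma not_less_zero [simp]: "\<not> a \<prec> \<zero>"
proof -
  obtain E where "\<forall>e. sat M e E (\<^bold>\<not> Var ''m'' \<^bold>< \<^bold>0)"
    using sat_basic[of "\<^bold>\<not> Var ''m'' \<^bold>< \<^bold>0"] by (auto simp: basic_axioms_def)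
  from spec[OF this, of "\<lambda>x. a"] show ?thesis by auto
qed

lemma less_succ: "a \<prec> b \<oplus> \<one> \<longleftrightarrow> a \<prec> b \<or> a = b"
proof -
  let ?\<phi> = "Var ''m'' \<^bold>< Var ''n'' \<^bold>+ \<^bold>1 \<^bold>\<leftrightarrow> Var ''m'' \<^bold>< Var ''n'' \<^bold>\<or> Var ''m'' \<^bold>= Var ''n''"
  obtain E where "\<forall>e. sat M e E ?\<phi>" using sat_basic[of ?\<phi>] by (auto simp: basic_axioms_def)
  from spec[OF this, of "\<lambda>x. if x = ''m'' then a else b"] show ?thesis by auto
qed

section \<open>Induction and bounded comprehension for sets of the model\<close>

lemma sat_induction_fm:
  "sat M e E (induction_fm x \<phi>) \<longleftrightarrow>
    (sat M (e(x := \<zero>)) E \<phi> \<and> (\<forall>a. sat M (e(x := a)) E \<phi> \<longrightarrow> sat M (e(x := a \<oplus> \<one>)) E \<phi>)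
      \<longrightarrow> (\<forall>a. sat M (e(x := a)) E \<phi>))"
  by (simp add: induction_fm_def sat_subst_num)

text \<open>
  A vacuous quantifier over a fresh variable turns a bounded formula into a \<open>\<Sigma>\<close> formula and
  into an equivalent \<open>\<Pi>\<close> formula.
\<close>

lemma bounded_comprehension:
  assumes "bounded \<theta>" and E: "range E \<subseteq> sets"
  shows "{a. sat M (e(x := a)) E \<theta>} \<in> sets"
proof -
  obtain y where y: "y \<notin> insert x (free_num \<theta>)"
    using ex_fresh_name[of "insert x (free_num \<theta>)"] finite_free_num by blast
  obtain X where X: "X \<notin> free_set \<theta>" using ex_fresh_name finite_free_set by blast
  let ?c = "(\<^bold>\<forall>N x. (\<^bold>\<exists>N y. \<theta>) \<^bold>\<leftrightarrow> (\<^bold>\<forall>N y. \<theta>)) \<^bold>\<rightarrow> comprehension_fm X x (\<^bold>\<exists>N y. \<theta>)"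
  have "?c \<in> RCA0"
    unfolding RCA0_def using assms(1) X by (auto intro!: sigma01.intros pi01.intros)
  then have "sat M e E ?c" using E by (rule sat_RCA0)
  then obtain A where "A \<in> sets" "\<And>a. a \<in> A \<longleftrightarrow> sat M (e(x := a)) E \<theta>"
    using y X by (auto simp: comprehension_fm_def sat_fun_upd_num sat_fun_upd_set)
  moreover then have "A = {a. sat M (e(x := a)) E \<theta>}" by blast
  ultimately show ?thesis by simp
qed

text \<open>One fixed instance of the induction scheme suffices: membership of \<open>''x''\<close>
  in \<open>''X''\<close> under a vacuous quantifier. The predicate enters only as the value of
  \<open>''X''\<close>, so each later induction only has to show that its predicate defines a
  set.\<close>

lemma set_induct [case_names in_sets zero succ]:
  assumes "{a. P a} \<in> sets" and "P \<zero>" and "\<And>a. P a \<Longrightarrow> P (a \<oplus> \<one>)"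
  shows "P a"
proof -
  let ?\<phi> = "\<^bold>\<exists>N ''y''. Var ''x'' \<^bold>\<in> ''X''"
  have "induction_fm ''x'' ?\<phi> \<in> RCA0"
    unfolding RCA0_def by (auto intro!: sigma01.intros bounded.intros)
  then have "sat M (\<lambda>_. \<zero>) (\<lambda>_. {a. P a}) (induction_fm ''x'' ?\<phi>)"
    by (rule sat_RCA0) (use assms(1) in auto)
  then show ?thesis using assms(2,3) by (simp add: sat_induction_fm)
qed

lemma empty_in_sets [simp]: "{} \<in> sets"
proof -
  obtain A where "A \<in> sets" using set_part_nonempty by blast
  then show ?thesis
    using bounded_comprehension[of "\<^bold>\<not> \<^bold>0 \<^bold>= \<^bold>0" "\<lambda>_. A"] by (simp add: bounded.intros image_subset_iff)
qed

text \<open>A template with fixed names. \<open>''x''\<close> ranges over the candidates,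
  \<open>''y''\<close> and \<open>''z''\<close> hold number parameters, \<open>''B''\<close> holds
  \<open>B\<close>, and every other set name, such as \<open>''A''\<close>, \<open>''C''\<close> or
  \<open>''Y''\<close> in later uses, holds \<open>A\<close>.\<close>

lemma arith_comprehension:
  assumes "bounded \<theta>" and "A \<in> sets" and "B \<in> sets"
  shows "{a. sat M ((\<lambda>_. \<zero>)(''x'' := a, ''y'' := b, ''z'' := c)) ((\<lambda>_. A)(''B'' := B)) \<theta>} \<in> sets"
    (is "?S \<in> _")
proof -
  have "?S = {a. sat M ((\<lambda>_. \<zero>)(''y'' := b, ''z'' := c, ''x'' := a)) ((\<lambda>_. A)(''B'' := B)) \<theta>}"
    by (simp add: fun_upd_twist)
  then show ?thesis
    using bounded_comprehension[OF assms(1), of "(\<lambda>_. A)(''B'' := B)"] assms(2,3)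
    by (simp add: image_subset_iff)
qed

lemmas arith_set = arith_comprehension[OF _ empty_in_sets empty_in_sets]

abbreviation (input) "vx \<equiv> Var ''x''"
abbreviation (input) "vy \<equiv> Var ''y''"
abbreviation (input) "vz \<equiv> Var ''z''"

section \<open>Semiring laws and cancellation, by set induction\<close>

lemma zero_add [simp]: "\<zero> \<oplus> a = a"
proof (induction a rule: set_induct)
  show "{a. \<zero> \<oplus> a = a} \<in> sets"
    using arith_set[of "\<^bold>0 \<^bold>+ vx \<^bold>= vx"] by (simp add: bounded.intros)
qed (simp_all add: add_succ)

lemma one_neq_zero [simp]: "\<one> \<noteq> \<zero>" "\<zero> \<noteq> \<one>"
  using succ_neq_zero[of \<zero>] by simp_all

lemma succ_add: "(a \<oplus> \<one>) \<oplus> b = (a \<oplus> b) \<oplus> \<one>"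
proof (induction b rule: set_induct)
  show "{b. (a \<oplus> \<one>) \<oplus> b = (a \<oplus> b) \<oplus> \<one>} \<in> sets"
    using arith_set[of "(vy \<^bold>+ \<^bold>1) \<^bold>+ vx \<^bold>= (vy \<^bold>+ vx) \<^bold>+ \<^bold>1" a] by (simp add: bounded.intros)
qed (simp_all add: add_succ)

lemma add_comm: "a \<oplus> b = b \<oplus> a"
proof (induction b rule: set_induct)
  show "{b. a \<oplus> b = b \<oplus> a} \<in> sets"
    using arith_set[of "vy \<^bold>+ vx \<^bold>= vx \<^bold>+ vy" a] by (simp add: bounded.intros)
qed (simp_all add: add_succ succ_add)

lemma add_assoc: "(a \<oplus> b) \<oplus> c = a \<oplus> (b \<oplus> c)"
proof (induction c rule: set_induct)
  show "{c. (a \<oplus> b) \<oplus> c = a \<oplus> (b \<oplus> c)} \<in> sets"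
    using arith_set[of "(vy \<^bold>+ vz) \<^bold>+ vx \<^bold>= vy \<^bold>+ (vz \<^bold>+ vx)" a b] by (simp add: bounded.intros)
qed (simp_all add: add_succ)

lemma add_left_comm: "a \<oplus> (b \<oplus> c) = b \<oplus> (a \<oplus> c)"
  using add_assoc[of a b c] add_assoc[of b a c] add_comm[of a b] by simp

lemmas add_ac = add_assoc add_comm add_left_comm

lemma zero_mul [simp]: "\<zero> \<otimes> a = \<zero>"
proof (induction a rule: set_induct)
  show "{a. \<zero> \<otimes> a = \<zero>} \<in> sets"
    using arith_set[of "\<^bold>0 \<^bold>* vx \<^bold>= \<^bold>0"] by (simp add: bounded.intros)
qed (simp_all add: mul_succ)

lemma succ_mul: "(a \<oplus> \<one>) \<otimes> b = a \<otimes> b \<oplus> b"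
proof (induction b rule: set_induct)
  show "{b. (a \<oplus> \<one>) \<otimes> b = a \<otimes> b \<oplus> b} \<in> sets"
    using arith_set[of "(vy \<^bold>+ \<^bold>1) \<^bold>* vx \<^bold>= vy \<^bold>* vx \<^bold>+ vx" a] by (simp add: bounded.intros)
qed (simp_all add: mul_succ add_ac)

lemma mul_comm: "a \<otimes> b = b \<otimes> a"
proof (induction b rule: set_induct)
  show "{b. a \<otimes> b = b \<otimes> a} \<in> sets"
    using arith_set[of "vy \<^bold>* vx \<^bold>= vx \<^bold>* vy" a] by (simp add: bounded.intros)
qed (simp_all add: mul_succ succ_mul)

lemma distrib_left: "a \<otimes> (b \<oplus> c) = a \<otimes> b \<oplus> a \<otimes> c"
proof (induction c rule: set_induct)
  show "{c. a \<otimes> (b \<oplus> c) = a \<otimes> b \<oplus> a \<otimes> c} \<in> sets"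
    using arith_set[of "vy \<^bold>* (vz \<^bold>+ vx) \<^bold>= vy \<^bold>* vz \<^bold>+ vy \<^bold>* vx" a b]
    by (simp add: bounded.intros)
next
  case (succ c)
  have "a \<otimes> (b \<oplus> (c \<oplus> \<one>)) = a \<otimes> (b \<oplus> c) \<oplus> a" by (simp only: add_succ mul_succ)
  then show ?case by (simp only: succ mul_succ add_assoc)
qed simp

lemma distrib_right: "(a \<oplus> b) \<otimes> c = a \<otimes> c \<oplus> b \<otimes> c"
  by (metis distrib_left mul_comm)

lemma mul_one [simp]: "a \<otimes> \<one> = a" "\<one> \<otimes> a = a"
  using mul_succ[of a \<zero>] mul_comm by auto

lemma mul_assoc: "(a \<otimes> b) \<otimes> c = a \<otimes> (b \<otimes> c)"
proof (induction c rule: set_induct)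
  show "{c. (a \<otimes> b) \<otimes> c = a \<otimes> (b \<otimes> c)} \<in> sets"
    using arith_set[of "(vy \<^bold>* vz) \<^bold>* vx \<^bold>= vy \<^bold>* (vz \<^bold>* vx)" a b] by (simp add: bounded.intros)
qed (simp_all add: distrib_left)

lemma mul_left_comm: "a \<otimes> (b \<otimes> c) = b \<otimes> (a \<otimes> c)"
  using mul_assoc[of a b c] mul_assoc[of b a c] mul_comm[of a b] by simp

lemmas semiring = add_ac distrib_left distrib_right mul_assoc mul_comm mul_left_comm

lemma add_right_cancel [simp]: "a \<oplus> c = b \<oplus> c \<longleftrightarrow> a = b"
proof (induction c rule: set_induct)
  show "{c. (a \<oplus> c = b \<oplus> c) = (a = b)} \<in> sets"
    using arith_set[of "vy \<^bold>+ vx \<^bold>= vz \<^bold>+ vx \<^bold>\<leftrightarrow> vy \<^bold>= vz" a b] by (simp add: bounded.intros)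
qed (simp_all add: add_succ)

lemma add_left_cancel [simp]: "c \<oplus> a = c \<oplus> b \<longleftrightarrow> a = b"
  by (metis add_comm add_right_cancel)

lemma add_eq_self [simp]: "a \<oplus> b = a \<longleftrightarrow> b = \<zero>" "a = a \<oplus> b \<longleftrightarrow> b = \<zero>"
  using add_left_cancel[of a b \<zero>] add_left_cancel[of a \<zero> b] by auto

section \<open>The order, differences and least elements\<close>

lemma less_add_succ: "a \<prec> a \<oplus> (c \<oplus> \<one>)"
proof (induction c rule: set_induct)
  show "{c. a \<prec> a \<oplus> (c \<oplus> \<one>)} \<in> sets"
    using arith_set[of "vy \<^bold>< vy \<^bold>+ (vx \<^bold>+ \<^bold>1)" a] by (simp add: bounded.intros)
next
  case (succ c)
  then show ?case using add_succ[of a "c \<oplus> \<one>"] by (simp add: less_succ)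
qed (simp add: less_succ)

lemma zero_or_succ: "a = \<zero> \<or> (\<exists>b. a = b \<oplus> \<one>)"
proof -
  \<comment> \<open>Bounding the predecessor makes the induction predicate definable by a bounded
    formula. The proof of \<open>less_iff_add\<close> bounds the difference for the same
    reason.\<close>
  have "a = \<zero> \<or> (\<exists>b. b \<prec> a \<and> a = b \<oplus> \<one>)"
  proof (induction a rule: set_induct)
    let ?\<phi> = "vx \<^bold>= \<^bold>0 \<^bold>\<or> (\<^bold>\<exists>N ''b''. Var ''b'' \<^bold>< vx \<^bold>\<and> vx \<^bold>= Var ''b'' \<^bold>+ \<^bold>1)"
    show "{a. a = \<zero> \<or> (\<exists>b. b \<prec> a \<and> a = b \<oplus> \<one>)} \<in> sets"
      using arith_set[of ?\<phi>] by (simp add: bounded.intros)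
  qed (auto simp: less_succ)
  then show ?thesis by blast
qed

lemma not_zero_iff: "a \<noteq> \<zero> \<longleftrightarrow> (\<exists>b. a = b \<oplus> \<one>)"
  using zero_or_succ by auto

lemma add_eq_zero [simp]: "a \<oplus> b = \<zero> \<longleftrightarrow> a = \<zero> \<and> b = \<zero>"
  using zero_or_succ[of b] by (auto simp: add_succ)

lemma less_iff_add: "a \<prec> b \<longleftrightarrow> (\<exists>c. b = a \<oplus> (c \<oplus> \<one>))"
proof
  have "\<not> a \<prec> b \<or> (\<exists>c. c \<prec> b \<and> b = a \<oplus> (c \<oplus> \<one>))"
  proof (induction b rule: set_induct)
    let ?\<phi> = "\<^bold>\<not> vy \<^bold>< vx \<^bold>\<or>
      (\<^bold>\<exists>N ''c''. Var ''c'' \<^bold>< vx \<^bold>\<and> vx \<^bold>= vy \<^bold>+ (Var ''c'' \<^bold>+ \<^bold>1))"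
    show "{b. \<not> a \<prec> b \<or> (\<exists>c. c \<prec> b \<and> b = a \<oplus> (c \<oplus> \<one>))} \<in> sets"
      using arith_set[of ?\<phi> a] by (simp add: bounded.intros)
  next
    case (succ b)
    have "\<exists>c. c \<prec> b \<oplus> \<one> \<and> b \<oplus> \<one> = a \<oplus> (c \<oplus> \<one>)" if ab: "a \<prec> b \<oplus> \<one>"
    proof (cases "a = b")
      case True
      have "\<zero> \<prec> b \<oplus> \<one>" using less_add_succ[of \<zero> b] by simp
      then show ?thesis using True by (intro exI[of _ \<zero>]) simp
    next
      case False
      then obtain c where c: "b = a \<oplus> (c \<oplus> \<one>)" using ab succ by (auto simp: less_succ)
      \<comment> \<open>The new witness \<open>c \<oplus> \<one>\<close> must lie below
        \<open>b \<oplus> \<one>\<close>; it does, being a summand of \<open>b\<close>.\<close>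
      have "c \<oplus> \<one> \<prec> b \<or> c \<oplus> \<one> = b"
        using zero_or_succ[of a] less_add_succ[of "c \<oplus> \<one>"] unfolding c by (metis add_comm zero_add)
      then show ?thesis using c by (intro exI[of _ "c \<oplus> \<one>"]) (simp add: less_succ add_succ)
    qed
    then show ?case by blast
  qed simp
  then show "\<exists>c. b = a \<oplus> (c \<oplus> \<one>)" if "a \<prec> b" using that by blast
qed (use less_add_succ in blast)

lemma less_linear: "a \<prec> b \<or> a = b \<or> b \<prec> a"
proof (induction b rule: set_induct)
  show "{b. a \<prec> b \<or> a = b \<or> b \<prec> a} \<in> sets"
    using arith_set[of "vy \<^bold>< vx \<^bold>\<or> vy \<^bold>= vx \<^bold>\<or> vx \<^bold>< vy" a] by (simp add: bounded.intros)
next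
  case zero
  show ?case using zero_or_succ[of a] less_add_succ[of \<zero>] by auto
next
  case (succ b)
  have "b \<oplus> \<one> = a \<or> b \<oplus> \<one> \<prec> a" if ba: "b \<prec> a" for b
  proof -
    obtain c where c: "a = b \<oplus> (c \<oplus> \<one>)" using ba unfolding less_iff_add by blast
    then have "a = (b \<oplus> \<one>) \<oplus> c" by (simp only: add_ac)
    then show ?thesis using zero_or_succ[of c] less_add_succ[of "b \<oplus> \<one>"] by auto
  qed
  then show ?case using succ by (auto simp: less_succ)
qed

text \<open>Stated by a difference instead of through the order, so that transitivity and the bounds
  on pairs become algebra.\<close>

definition le (infix "\<preceq>" 50) where "a \<preceq> b \<longleftrightarrow> (\<exists>c. b = a \<oplus> c)"

lemma less_succ_iff_le: "a \<prec> b \<oplus> \<one> \<longleftrightarrow> a \<preceq> b"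
  by (simp add: less_iff_add le_def add_assoc[symmetric])

lemma le_add1: "a \<preceq> a \<oplus> b"
  unfolding le_def by blast

lemma le_add2: "a \<preceq> b \<oplus> a"
  unfolding le_def using add_comm by blast

lemma le_refl [simp, intro]: "a \<preceq> a"
  using le_add1[of a \<zero>] by simp

lemma le_trans [trans]: "a \<preceq> b \<Longrightarrow> b \<preceq> c \<Longrightarrow> a \<preceq> c"
  unfolding le_def using add_assoc by auto

lemma le_succ [intro]: "a \<preceq> b \<Longrightarrow> a \<preceq> b \<oplus> \<one>"
  using le_trans le_add1 by blast

lemma less_imp_le: "a \<prec> b \<Longrightarrow> a \<preceq> b"
  unfolding less_iff_add le_def by blast

lemma less_irrefl [simp]: "\<not> a \<prec> a"
  by (simp add: less_iff_add)

lemma not_less: "\<not> a \<prec> b \<longleftrightarrow> b \<preceq> a"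
proof
  show "b \<preceq> a" if "\<not> a \<prec> b" using that less_linear[of a b] less_imp_le by auto
  show "\<not> a \<prec> b" if "b \<preceq> a"
    using that by (auto simp: le_def less_iff_add add_assoc)
qed

text \<open>If no member were least, induction on \<open>x\<close> would show that \<open>A\<close>
  has no member below any \<open>x\<close>, contradicting \<open>a \<in> A\<close> at
  \<open>x = a \<oplus> \<one>\<close>. The induction predicate has only a bounded quantifier, hence
  defines a set.\<close>

lemma least_element:
  assumes A: "A \<in> sets" and "a \<in> A"
  obtains b where "b \<in> A" and "\<And>d. d \<prec> b \<Longrightarrow> d \<notin> A"
proof -
  have "\<exists>b\<in>A. \<forall>d. d \<prec> b \<longrightarrow> d \<notin> A"
  proof (rule ccontr)
    assume no_least: "\<not> ?thesis"
    have "\<forall>d. d \<prec> x \<longrightarrow> d \<notin> A" for x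
    proof (induction x rule: set_induct)
      show "{x. \<forall>d. d \<prec> x \<longrightarrow> d \<notin> A} \<in> sets"
        using arith_comprehension[of "\<^bold>\<forall>N ''d''. Var ''d'' \<^bold>< vx \<^bold>\<rightarrow> \<^bold>\<not> Var ''d'' \<^bold>\<in> ''A''" A A]
        using A by (simp add: bounded.intros)
    qed (use no_least in \<open>auto simp: less_succ\<close>)
    from this[of "a \<oplus> \<one>"] show False using \<open>a \<in> A\<close> by (auto simp: less_succ)
  qed
  then show thesis using that by blast
qed

section \<open>The pairing function and its injectivity\<close>

definition pair :: "'a \<Rightarrow> 'a \<Rightarrow> 'a" where
  "pair a b = (a \<oplus> b) \<otimes> (a \<oplus> b) \<oplus> a"

lemma tm_val_pair_tm [simp]: "tm_val M e (pair_tm s t) = pair (tm_val M e s) (tm_val M e t)"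
  by (simp add: pair_tm_def pair_def)

lemma tm_vars_pair_tm [simp]: "tm_vars (pair_tm s t) = tm_vars s \<union> tm_vars t"
  by (auto simp: pair_tm_def)

lemma le_pair1 [intro]: "c \<preceq> a \<Longrightarrow> c \<preceq> pair a b"
  unfolding pair_def by (rule le_trans[OF _ le_add2])

lemma le_pair2 [intro]: "c \<preceq> b \<Longrightarrow> c \<preceq> pair a b"
proof -
  have square: "u \<preceq> u \<otimes> u" for u
    using zero_or_succ[of u] mul_succ[of u] le_add2 by auto
  assume "c \<preceq> b"
  also have "b \<preceq> a \<oplus> b" by (rule le_add2)
  also have "a \<oplus> b \<preceq> (a \<oplus> b) \<otimes> (a \<oplus> b)" by (rule square)
  also have "\<dots> \<preceq> pair a b" unfolding pair_def by (rule le_add1)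
  finally show "c \<preceq> pair a b" .
qed

text \<open>With \<open>s = a \<oplus> b\<close>, the code of \<open>(a, b)\<close> is at most the
  square of \<open>s\<close> plus \<open>s\<close>, hence below the square of
  \<open>s \<oplus> \<one>\<close>, which the other code reaches. The long term in the proof is the
  exact difference, written as a successor.\<close>

lemma pair_less:
  assumes "a \<oplus> b \<prec> a' \<oplus> b'"
  shows "pair a b \<prec> pair a' b'"
proof -
  obtain c where "a' \<oplus> b' = (a \<oplus> b) \<oplus> (c \<oplus> \<one>)" using assms unfolding less_iff_add by blast
  then have "pair a' b' = ((a \<oplus> b) \<oplus> (c \<oplus> \<one>)) \<otimes> ((a \<oplus> b) \<oplus> (c \<oplus> \<one>)) \<oplus> a'"
    by (simp add: pair_def)
  also have "\<dots> = pair a b \<oplus>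
      ((b \<oplus> (a \<oplus> b) \<otimes> c \<oplus> c \<otimes> (a \<oplus> b) \<oplus> a \<oplus> b \<oplus> c \<oplus> c \<oplus> c \<otimes> c \<oplus> a') \<oplus> \<one>)"
    unfolding pair_def by (simp add: semiring)
  finally show ?thesis unfolding less_iff_add by blast
qed

lemma pair_inject [simp]: "pair a b = pair a' b' \<longleftrightarrow> a = a' \<and> b = b'"
proof
  assume eq: "pair a b = pair a' b'"
  then have "a \<oplus> b = a' \<oplus> b'"
    using less_linear[of "a \<oplus> b" "a' \<oplus> b'"] pair_less[of a b a' b'] pair_less[of a' b' a b]
    by auto
  moreover from this eq have "a = a'" by (simp add: pair_def)
  ultimately show "a = a' \<and> b = b'" by simp
qed simp


section \<open>Indices of finite sets\<close>

lemma sat_bex: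
  "x \<notin> tm_vars t \<Longrightarrow>
    sat M e E (bex x t \<phi>) \<longleftrightarrow> (\<exists>a. a \<preceq> tm_val M e t \<and> sat M (e(x := a)) E \<phi>)"
  by (simp add: bex_def less_succ_iff_le)

definition represents :: "'a \<Rightarrow> 'a set \<Rightarrow> bool" where
  "represents c F \<longleftrightarrow> (\<exists>k m n. c = pair k (pair m n) \<and>
    (\<forall>i. i \<in> F \<longleftrightarrow> i \<prec> k \<and> (\<exists>q. n = q \<otimes> (m \<otimes> (i \<oplus> \<one>) \<oplus> \<one>))))"

definition is_index :: "'a \<Rightarrow> 'a set \<Rightarrow> bool" where
  "is_index c F \<longleftrightarrow> represents c F \<and> (\<forall>d. d \<prec> c \<longrightarrow> \<not> represents d F)"

lemma sat_represents_fm: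
  "c \<notin> {''k'', ''m'', ''n'', ''i'', ''q''} \<Longrightarrow>
    sat M e E (represents_fm c X) \<longleftrightarrow> represents (e c) (E X)"
  by (simp add: represents_fm_def represents_def)

lemma sat_index_fm:
  "c \<notin> {''k'', ''m'', ''n'', ''i'', ''q'', ''d''} \<Longrightarrow>
    sat M e E (index_fm c X) \<longleftrightarrow> is_index (e c) (E X)"
  by (simp add: index_fm_def is_index_def sat_represents_fm)

lemma represents_unique: "represents c F \<Longrightarrow> represents c G \<Longrightarrow> F = G"
  unfolding represents_def by auto

lemma is_index_unique: "is_index c F \<Longrightarrow> is_index c G \<Longrightarrow> F = G"
  unfolding is_index_def using represents_unique by blast

text \<open>The member lies below \<open>k\<close>, the first component of \<open>c\<close>. This
  later bounds a quantifier over the member of a coded singleton.\<close>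

lemma represents_le: "represents c F \<Longrightarrow> a \<in> F \<Longrightarrow> a \<preceq> c"
  unfolding represents_def using less_imp_le by blast

text \<open>
  Take \<open>k = m = a + 1\<close> and \<open>n = m (a + 1) + 1\<close>. If \<open>n = q (m (i + 1) + 1)\<close> then
  \<open>q = m j + 1\<close> where \<open>a + 1 = q (i + 1) + j\<close>, and \<open>m > a\<close> forces \<open>j = 0\<close>, hence \<open>i = a\<close>.
\<close>

lemma represents_singleton: "\<exists>c. represents c {a}"
proof -
  define m where "m = a \<oplus> \<one>"
  have "i = a" if "i \<prec> m" and eq: "m \<otimes> (a \<oplus> \<one>) \<oplus> \<one> = q \<otimes> (m \<otimes> (i \<oplus> \<one>) \<oplus> \<one>)" for i q
  proof -
    have "q \<noteq> \<zero>" using eq by auto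
    then obtain r where r: "q = r \<oplus> \<one>" using not_zero_iff by blast
    have "m \<otimes> (a \<oplus> \<one>) \<oplus> \<one> = (m \<otimes> (q \<otimes> (i \<oplus> \<one>)) \<oplus> r) \<oplus> \<one>"
      unfolding eq r by (simp add: semiring)
    then have eq': "m \<otimes> (a \<oplus> \<one>) = m \<otimes> (q \<otimes> (i \<oplus> \<one>)) \<oplus> r" by simp
    have "\<not> a \<oplus> \<one> \<prec> q \<otimes> (i \<oplus> \<one>)"
    proof
      assume "a \<oplus> \<one> \<prec> q \<otimes> (i \<oplus> \<one>)"
      then obtain c where c: "q \<otimes> (i \<oplus> \<one>) = (a \<oplus> \<one>) \<oplus> (c \<oplus> \<one>)" unfolding less_iff_add by blast
      have "m \<otimes> (a \<oplus> \<one>) = m \<otimes> (a \<oplus> \<one>) \<oplus> (m \<otimes> (c \<oplus> \<one>) \<oplus> r)"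
        using eq' unfolding c distrib_left[of m "a \<oplus> \<one>"] add_assoc[of "m \<otimes> (a \<oplus> \<one>)"] .
      then show False by (simp add: m_def mul_succ)
    qed
    then obtain j where j: "a \<oplus> \<one> = q \<otimes> (i \<oplus> \<one>) \<oplus> j" unfolding not_less le_def by blast
    have mj: "r = m \<otimes> j" using eq' unfolding j distrib_left by simp
    show ?thesis
    proof (cases "j = \<zero>")
      case True
      then show ?thesis using j mj r by simp
    next
      case False
      then obtain l where l: "j = l \<oplus> \<one>" using not_zero_iff by blast
      \<comment> \<open>A nonzero \<open>j\<close> makes \<open>r = m \<otimes> j\<close> at least
        \<open>m\<close>, so \<open>q\<close> exceeds \<open>a \<oplus> \<one>\<close>, of which it
        is a summand. Expansion exhibits the impossible excess.\<close>
      have "a \<oplus> \<one> = (a \<oplus> \<one>) \<oplus> ((r \<otimes> i \<oplus> i \<oplus> \<one> \<oplus> (a \<oplus> \<one>) \<otimes> l \<oplus> l) \<oplus> \<one>)"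
      proof -
        have "q \<otimes> (i \<oplus> \<one>) \<oplus> j = r \<otimes> i \<oplus> r \<oplus> i \<oplus> \<one> \<oplus> l \<oplus> \<one>"
          unfolding r l by (simp add: semiring)
        also have "\<dots> = r \<otimes> i \<oplus> m \<otimes> (l \<oplus> \<one>) \<oplus> i \<oplus> \<one> \<oplus> l \<oplus> \<one>"
          using mj l by simp
        also have "\<dots> = (a \<oplus> \<one>) \<oplus> ((r \<otimes> i \<oplus> i \<oplus> \<one> \<oplus> (a \<oplus> \<one>) \<otimes> l \<oplus> l) \<oplus> \<one>)"
          unfolding m_def by (simp add: semiring)
        finally show ?thesis using j by simp
      qed
      then show ?thesis by (simp only: add_eq_self succ_neq_zero)
    qed
  qed
  moreover have "m \<otimes> (a \<oplus> \<one>) \<oplus> \<one> = \<one> \<otimes> (m \<otimes> (a \<oplus> \<one>) \<oplus> \<one>)" by simp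
  moreover have "a \<prec> m" by (simp add: m_def less_succ)
  ultimately have "represents (pair m (pair m (m \<otimes> (a \<oplus> \<one>) \<oplus> \<one>))) {a}"
    unfolding represents_def by blast
  then show ?thesis by blast
qed

text \<open>Unlike \<open>represents_fm\<close>, this has only bounded quantifiers and no set
  variable, so it can occur in comprehension. The condition on all \<open>i\<close> is split into
  \<open>a\<close> being below \<open>k\<close> and a test of the \<open>i\<close> below
  \<open>k\<close>.\<close>

definition singleton_fm :: "name \<Rightarrow> name \<Rightarrow> fm" where
  "singleton_fm c a =
    bex ''k'' (Var c) (bex ''m'' (Var c) (bex ''n'' (Var c)
      (Var c \<^bold>= pair_tm (Var ''k'') (pair_tm (Var ''m'') (Var ''n'')) \<^bold>\<and> Var a \<^bold>< Var ''k'' \<^bold>\<and>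
       (\<^bold>\<forall>N ''i''. Var ''i'' \<^bold>< Var ''k'' \<^bold>\<rightarrow>
         (Var ''i'' \<^bold>= Var a \<^bold>\<leftrightarrow>
          bex ''q'' (Var ''n'')
            (Var ''n'' \<^bold>= Var ''q'' \<^bold>* (Var ''m'' \<^bold>* (Var ''i'' \<^bold>+ \<^bold>1) \<^bold>+ \<^bold>1)))))))"

lemma bounded_singleton_fm:
  "c \<notin> {''k'', ''m'', ''n''} \<Longrightarrow> bounded (singleton_fm c a)"
  unfolding singleton_fm_def by (intro bounded_rules) auto

lemma sat_singleton_fm:
  assumes "c \<notin> {''k'', ''m'', ''n'', ''i'', ''q''}" and "a \<notin> {''k'', ''m'', ''n'', ''i'', ''q''}"
  shows "sat M e E (singleton_fm c a) \<longleftrightarrow> represents (e c) {e a}"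
proof -
  let ?div = "\<lambda>m n i q. n = q \<otimes> (m \<otimes> (i \<oplus> \<one>) \<oplus> \<one>)"
  \<comment> \<open>The divisor is a successor, so the quotient is at most \<open>n\<close> and may
    be quantified boundedly.\<close>
  have le: "?div m n i q \<Longrightarrow> q \<preceq> n" for m n i q
    by (simp add: distrib_left le_add2)
  have "sat M e E (singleton_fm c a) \<longleftrightarrow> (\<exists>k m n. k \<preceq> e c \<and> m \<preceq> e c \<and> n \<preceq> e c \<and>
      e c = pair k (pair m n) \<and> e a \<prec> k \<and>
      (\<forall>i. i \<prec> k \<longrightarrow> (i = e a \<longleftrightarrow> (\<exists>q. q \<preceq> n \<and> ?div m n i q))))"
    using assms by (auto simp: singleton_fm_def sat_bex)
  also have "\<dots> \<longleftrightarrow> (\<exists>k m n. e c = pair k (pair m n) \<and> e a \<prec> k \<and>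
      (\<forall>i. i \<prec> k \<longrightarrow> (i = e a \<longleftrightarrow> (\<exists>q. ?div m n i q))))"
    using le by (intro ex_cong1) (metis le_pair1 le_pair2 le_refl)
  also have "\<dots> \<longleftrightarrow> represents (e c) {e a}"
    unfolding represents_def by (intro ex_cong1) auto
  finally show ?thesis .
qed

lemma singleton_in_sets: "{a} \<in> sets"
  using arith_set[of "vx \<^bold>= vy" a] by (simp add: bounded.intros)

text \<open>By the bounded description, the codes of \<open>{a}\<close> form a set of the model; its
  least element is the index.\<close>

lemma index_singleton: "\<exists>c. is_index c {a}"
proof -
  have "{c. represents c {a}} \<in> sets"
    using arith_set[of "singleton_fm ''x'' ''y''" a]
    by (simp add: bounded_singleton_fm sat_singleton_fm)
  moreover obtain c where "c \<in> {c. represents c {a}}" using represents_singleton by blast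
  ultimately obtain b where "b \<in> {c. represents c {a}}"
      and "\<And>d. d \<prec> b \<Longrightarrow> d \<notin> {c. represents c {a}}"
    by (rule least_element) blast
  then show ?thesis unfolding is_index_def by blast
qed

end

section \<open>Closure extension yields projections\<close>

locale ce_model = rca0_model +
  assumes models_CE: "M \<Turnstile> QF_CE"
begin

definition closed_under :: "'a set \<Rightarrow> 'a set \<Rightarrow> bool" where
  "closed_under D A \<longleftrightarrow>
    (\<forall>c n. \<forall>F\<in>sets. pair c n \<in> D \<and> is_index c F \<and> F \<subseteq> A \<longrightarrow> n \<in> A)"

lemma sat_subset_fm: "sat M e E (subset_fm X Y) \<longleftrightarrow> E X \<subseteq> E Y"
  by (auto simp: subset_fm_def)

lemma sat_closed_fm:
  "D \<noteq> ''F'' \<Longrightarrow> A \<noteq> ''F'' \<Longrightarrow>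
    sat M e E (closed_fm D A) \<longleftrightarrow> closed_under (E D) (E A)"
  by (simp add: closed_fm_def closed_under_def sat_index_fm sat_subset_fm)

lemma UNIV_in_sets [simp]: "UNIV \<in> sets"
  using arith_set[of "\<^bold>0 \<^bold>= \<^bold>0"] by (simp add: bounded.intros)

text \<open>Closure extension with the whole universe as ambient set, starting from the empty set;
  hence the requirement that the empty set be closed.\<close>

lemma maximal_closed_set:
  assumes D: "D \<in> sets"
    and op: "\<And>p. p \<in> D \<Longrightarrow> \<exists>c n. p = pair c n \<and> (\<exists>F\<in>sets. is_index c F)"
    and empty: "closed_under D {}"
  obtains C where "C \<in> sets" and "closed_under D C" and "\<zero> \<notin> C"
    and "\<And>B. B \<in> sets \<Longrightarrow> closed_under D B \<Longrightarrow> \<zero> \<notin> B \<Longrightarrow> C \<subseteq> B \<Longrightarrow> B \<subseteq> C"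
proof -
  let ?\<phi> = "\<^bold>\<not> \<^bold>0 \<^bold>\<in> ''X''"
  let ?E = "(\<lambda>_ :: name. {} :: 'a set)(''D'' := D, ''A'' := UNIV)"
  have "CE_fm ''X'' ?\<phi> \<in> QF_CE"
    unfolding QF_CE_def mem_Collect_eq
    by (intro exI[of _ "''X''"] exI[of _ ?\<phi>]) (simp add: quantifier_free.intros)
  then have sat: "sat M (\<lambda>_. \<zero>) (\<lambda>_. {}) (CE_fm ''X'' ?\<phi>)"
    using models_CE unfolding models_def by (auto simp: image_subset_iff)
  have "sat M (\<lambda>_. \<zero>) ?E (closure_op_fm ''D'')"
    using op by (auto simp: closure_op_fm_def sat_index_fm)
  moreover have "sat M (\<lambda>_. \<zero>) ?E (fin_char_fm ''X'' ?\<phi>)"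
  proof -
    \<comment> \<open>If a set contains \<open>\<zero>\<close>, then \<open>{\<zero>}\<close> is a
      finite subset at which the formula fails. This gives the passage from finite subsets to the
      whole set; \<open>k\<close> witnesses finiteness inside the model.\<close>
    have "\<exists>k. \<forall>i. i \<in> {\<zero>} \<longrightarrow> i \<prec> k"
      using less_succ by blast
    then show ?thesis
      using singleton_in_sets[of \<zero>]
      by (auto simp: fin_char_fm_def empty_fm_def finite_fm_def sat_subset_fm
          intro: bexI[of _ "{\<zero>}"])
  qed
  moreover have "sat M (\<lambda>_. \<zero>) (?E(''B'' := {})) (candidate_fm ''D'' ''A'' ''X'' ?\<phi> ''B'')"
    using empty by (simp add: candidate_fm_def sat_subset_fm sat_closed_fm)
  ultimately obtain C where "C \<in> sets" and
    C: "sat M (\<lambda>_. \<zero>) (?E(''B'' := {}, ''C'' := C)) (maximal_candidate_fm ''D'' ''A'' ''X'' ?\<phi> ''C'')"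
    using bspec[OF bspec[OF sat[unfolded CE_fm_def sat.simps] D] UNIV_in_sets] empty_in_sets
    by blast
  have "closed_under D C" "\<zero> \<notin> C"
    and "\<And>B. B \<in> sets \<Longrightarrow> closed_under D B \<Longrightarrow> \<zero> \<notin> B \<Longrightarrow> C \<subseteq> B \<Longrightarrow> B \<subseteq> C"
    using C unfolding maximal_candidate_fm_def candidate_fm_def
    by (auto simp: sat_subset_fm sat_closed_fm seteq_fm_def)
  with \<open>C \<in> sets\<close> show thesis by (rule that)
qed

text \<open>The shift by \<open>1\<close> keeps the codes of pairs apart from \<open>0\<close>.\<close>

definition fibre_op :: "'a set \<Rightarrow> 'a set" where
  "fibre_op Y = {p. \<exists>c n a w. p = pair c n \<and> is_index c {pair a w \<oplus> \<one>} \<and>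
    ((\<exists>b. n = pair b w \<oplus> \<one>) \<or> n = \<zero> \<and> pair a w \<in> Y)}"

text \<open>All witnesses are bounded by \<open>p\<close>: \<open>c\<close> and \<open>n\<close> are
  its components, the member \<open>s\<close> of the singleton is at most its index
  \<open>c\<close>, and \<open>a\<close> and \<open>w\<close> are at most \<open>s\<close>.
  Minimality of the index is itself a bounded condition.\<close>

lemma fibre_op_in_sets:
  assumes "Y \<in> sets"
  shows "fibre_op Y \<in> sets"
proof -
  let ?\<theta> = "bex ''c'' vx (bex ''t'' vx (bex ''a'' vx (bex ''w'' vx (bex ''s'' vx
    (vx \<^bold>= pair_tm (Var ''c'') (Var ''t'') \<^bold>\<and>
     Var ''s'' \<^bold>= pair_tm (Var ''a'') (Var ''w'') \<^bold>+ \<^bold>1 \<^bold>\<and>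
     singleton_fm ''c'' ''s'' \<^bold>\<and>
     (\<^bold>\<forall>N ''d''. Var ''d'' \<^bold>< Var ''c'' \<^bold>\<rightarrow> \<^bold>\<not> singleton_fm ''d'' ''s'') \<^bold>\<and>
     (bex ''b'' (Var ''t'') (Var ''t'' \<^bold>= pair_tm (Var ''b'') (Var ''w'') \<^bold>+ \<^bold>1) \<^bold>\<or>
      Var ''t'' \<^bold>= \<^bold>0 \<^bold>\<and> pair_tm (Var ''a'') (Var ''w'') \<^bold>\<in> ''Y''))))))"
  let ?P = "\<lambda>p c n a w s. p = pair c n \<and> s = pair a w \<oplus> \<one> \<and> is_index c {s} \<and>
    ((\<exists>b. n = pair b w \<oplus> \<one>) \<or> n = \<zero> \<and> pair a w \<in> Y)"
  have P_le: "c \<preceq> p \<and> n \<preceq> p \<and> a \<preceq> p \<and> w \<preceq> p \<and> s \<preceq> p" if P: "?P p c n a w s" for p c n a w s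
  proof -
    have "c \<preceq> p" "n \<preceq> p" using P by auto
    moreover have "represents c {s}" using P is_index_def by blast
    then have "s \<preceq> c" by (rule represents_le) simp
    moreover have "a \<preceq> s" "w \<preceq> s" using P by auto
    ultimately show ?thesis using le_trans by meson
  qed
  have b_le: "n = pair b w \<oplus> \<one> \<Longrightarrow> b \<preceq> n" for n b w
    by auto
  have "bounded ?\<theta>"
    by (intro bounded_rules bounded_singleton_fm) simp_all
  then have "{p. \<exists>c. c \<preceq> p \<and> (\<exists>n. n \<preceq> p \<and> (\<exists>a. a \<preceq> p \<and> (\<exists>w. w \<preceq> p \<and> (\<exists>s. s \<preceq> p \<and>
      p = pair c n \<and> s = pair a w \<oplus> \<one> \<and> represents c {s} \<and>
      (\<forall>d. d \<prec> c \<longrightarrow> \<not> represents d {s}) \<and>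
      ((\<exists>b. b \<preceq> n \<and> n = pair b w \<oplus> \<one>) \<or> n = \<zero> \<and> pair a w \<in> Y)))))} \<in> sets"
    using arith_comprehension[OF _ assms assms, of ?\<theta>] by (simp add: sat_bex sat_singleton_fm)
  also have "{p. \<exists>c. c \<preceq> p \<and> (\<exists>n. n \<preceq> p \<and> (\<exists>a. a \<preceq> p \<and> (\<exists>w. w \<preceq> p \<and> (\<exists>s. s \<preceq> p \<and>
      p = pair c n \<and> s = pair a w \<oplus> \<one> \<and> represents c {s} \<and>
      (\<forall>d. d \<prec> c \<longrightarrow> \<not> represents d {s}) \<and>
      ((\<exists>b. b \<preceq> n \<and> n = pair b w \<oplus> \<one>) \<or> n = \<zero> \<and> pair a w \<in> Y)))))}
    = {p. \<exists>c n a w s. ?P p c n a w s}" (is "Collect ?L = Collect ?R")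
  proof (rule Collect_cong)
    fix p
    have "?L p \<longleftrightarrow> (\<exists>c n a w s. c \<preceq> p \<and> n \<preceq> p \<and> a \<preceq> p \<and> w \<preceq> p \<and> s \<preceq> p \<and> ?P p c n a w s)"
      using b_le unfolding is_index_def by blast
    also have "\<dots> \<longleftrightarrow> ?R p"
      by (intro ex_cong1) (use P_le in blast)
    finally show "?L p \<longleftrightarrow> ?R p" .
  qed
  finally show ?thesis by (simp add: fibre_op_def)
qed

lemma projection_in_sets:
  assumes Y: "Y \<in> sets"
  shows "{w. \<exists>a. pair a w \<in> Y} \<in> sets"
proof -
  let ?D = "fibre_op Y"
  \<comment> \<open>Every premise is a singleton, which is never contained in the empty set.\<close>
  have "closed_under ?D {}"
    unfolding closed_under_def fibre_op_def by (auto dest: is_index_unique)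
  moreover have "\<exists>c n. p = pair c n \<and> (\<exists>F\<in>sets. is_index c F)" if "p \<in> ?D" for p
    using that singleton_in_sets unfolding fibre_op_def by blast
  ultimately obtain C where C: "C \<in> sets" "closed_under ?D C" "\<zero> \<notin> C"
    and maximal: "\<And>B. B \<in> sets \<Longrightarrow> closed_under ?D B \<Longrightarrow> \<zero> \<notin> B \<Longrightarrow> C \<subseteq> B \<Longrightarrow> B \<subseteq> C"
    using maximal_closed_set[OF fibre_op_in_sets[OF Y]] by blast
  have rule: "n \<in> C"
    if "pair a w \<oplus> \<one> \<in> C" and "(\<exists>b. n = pair b w \<oplus> \<one>) \<or> n = \<zero> \<and> pair a w \<in> Y" for a w n
  proof -
    obtain c where c: "is_index c {pair a w \<oplus> \<one>}" using index_singleton by blast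
    then have "pair c n \<in> ?D" unfolding fibre_op_def using that(2) by blast
    with c that(1) show ?thesis
      using C(2) singleton_in_sets unfolding closed_under_def by blast
  qed
  \<comment> \<open>Codes over \<open>w\<close> enter \<open>C\<close> all together, so the one with
    first component \<open>\<zero>\<close> decides for all of them, and the projection gets a
    definition without quantifiers.\<close>
  have "(\<exists>a. pair a w \<in> Y) \<longleftrightarrow> pair \<zero> w \<oplus> \<one> \<notin> C" for w
  proof
    assume "\<exists>a. pair a w \<in> Y"
    then show "pair \<zero> w \<oplus> \<one> \<notin> C" using rule C(3) by blast
  next
    assume notin: "pair \<zero> w \<oplus> \<one> \<notin> C"
    show "\<exists>a. pair a w \<in> Y"
    proof (rule ccontr)
      assume none: "\<not> ?thesis"
      \<comment> \<open>The whole fibre over \<open>w\<close> is added at once. Premises in it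
        generate only codes of the same fibre, since \<open>none\<close> blocks the rule that yields
        \<open>\<zero>\<close>. Maximality then puts the fibre into \<open>C\<close>.\<close>
      let ?B = "C \<union> {x. \<exists>a. x = pair a w \<oplus> \<one>}"
      have "{x. x \<in> C \<or> (\<exists>a. a \<preceq> x \<and> x = pair a w \<oplus> \<one>)} \<in> sets"
        using arith_comprehension[OF _ C(1) C(1),
            of "vx \<^bold>\<in> ''C'' \<^bold>\<or> bex ''a'' vx (vx \<^bold>= pair_tm (Var ''a'') vy \<^bold>+ \<^bold>1)" w]
        by (simp add: sat_bex bounded_rules)
      moreover have "a \<preceq> pair a w \<oplus> \<one>" for a
        by auto
      then have "?B = {x. x \<in> C \<or> (\<exists>a. a \<preceq> x \<and> x = pair a w \<oplus> \<one>)}" by blast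
      ultimately have "?B \<in> sets" by simp
      moreover have "closed_under ?D ?B"
        unfolding closed_under_def
      proof (intro allI ballI impI, elim conjE)
        fix c n F
        assume "pair c n \<in> ?D" and F: "is_index c F" "F \<subseteq> ?B"
        then obtain a v where "is_index c {pair a v \<oplus> \<one>}"
          and n: "(\<exists>b. n = pair b v \<oplus> \<one>) \<or> n = \<zero> \<and> pair a v \<in> Y"
          unfolding fibre_op_def by auto
        then have "F = {pair a v \<oplus> \<one>}" using F(1) is_index_unique by blast
        then have "pair a v \<oplus> \<one> \<in> C \<or> v = w" using F(2) by auto
        then show "n \<in> ?B" using rule n none by blast
      qed
      moreover have "\<zero> \<notin> ?B" using C(3) by simp
      ultimately have "?B \<subseteq> C" using maximal by blast
      then show False using notin by blast
    qed
  qed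
  moreover have "{w. pair \<zero> w \<oplus> \<one> \<notin> C} \<in> sets"
    using arith_comprehension[OF _ C(1) C(1), of "\<^bold>\<not> pair_tm \<^bold>0 vx \<^bold>+ \<^bold>1 \<^bold>\<in> ''C''"]
    by (simp add: bounded.intros)
  ultimately show ?thesis by simp
qed

section \<open>Arithmetical comprehension\<close>

text \<open>A template for sets of pairs: inside the formula, \<open>''a''\<close> and
  \<open>''w''\<close> name the components of the candidate \<open>''x''\<close>, which bounds them
  both. \<open>''a''\<close> is the component that a subsequent projection removes.\<close>

lemma pairs_in_sets:
  assumes "bounded \<theta>" and "A \<in> sets" and "B \<in> sets"
  shows "{p. \<exists>a w. p = pair a w \<and> sat M ((\<lambda>_. \<zero>)(''x'' := p, ''y'' := b, ''z'' := c, ''a'' := a, ''w'' := w))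
    ((\<lambda>_. A)(''B'' := B)) \<theta>} \<in> sets" (is "{p. \<exists>a w. p = pair a w \<and> ?P p a w} \<in> _")
proof -
  let ?\<theta> = "bex ''a'' vx (bex ''w'' vx (vx \<^bold>= pair_tm (Var ''a'') (Var ''w'') \<^bold>\<and> \<theta>))"
  have "bounded ?\<theta>"
    using assms(1) by (intro bounded_rules) simp_all
  then have "{p. \<exists>a. a \<preceq> p \<and> (\<exists>w. w \<preceq> p \<and> p = pair a w \<and> ?P p a w)} \<in> sets"
    using arith_comprehension[OF _ assms(2,3), of ?\<theta>] by (simp add: sat_bex)
  also have "{p. \<exists>a. a \<preceq> p \<and> (\<exists>w. w \<preceq> p \<and> p = pair a w \<and> ?P p a w)}
      = {p. \<exists>a w. p = pair a w \<and> ?P p a w}"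
    by (intro Collect_cong ex_cong1) (use le_pair1 le_pair2 le_refl in blast)
  finally show ?thesis .
qed

lemma Diff_in_sets: "A \<in> sets \<Longrightarrow> B \<in> sets \<Longrightarrow> A - B \<in> sets"
  using arith_comprehension[of "vx \<^bold>\<in> ''A'' \<^bold>\<and> \<^bold>\<not> vx \<^bold>\<in> ''B''" A B]
  by (simp add: bounded.intros set_diff_eq)

lemma Int_in_sets: "A \<in> sets \<Longrightarrow> B \<in> sets \<Longrightarrow> A \<inter> B \<in> sets"
  using arith_comprehension[of "vx \<^bold>\<in> ''A'' \<^bold>\<and> vx \<^bold>\<in> ''B''" A B]
  by (simp add: bounded.intros Int_def)

lemma Un_in_sets: "A \<in> sets \<Longrightarrow> B \<in> sets \<Longrightarrow> A \<union> B \<in> sets"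
  using arith_comprehension[of "vx \<^bold>\<in> ''A'' \<^bold>\<or> vx \<^bold>\<in> ''B''" A B]
  by (simp add: bounded.intros Un_def)

lemma ex_le_pair:
  "(\<exists>a. a \<preceq> p \<and> (\<exists>b. p = pair a b \<and> P a b)) \<longleftrightarrow> (\<exists>a b. p = pair a b \<and> P a b)"
  "(\<exists>b. b \<preceq> p \<and> p = pair a b \<and> Q b) \<longleftrightarrow> (\<exists>b. p = pair a b \<and> Q b)"
  using le_pair1 le_pair2 le_refl by blast+

text \<open>The two values are packed into one number \<open>u\<close>, so that a single projection
  removes both quantifiers.\<close>

lemma relation_in_sets:
  assumes "\<And>e E s t. sat M e E (rel s t) \<longleftrightarrow> R (tm_val M e s) (tm_val M e t)"
    and "\<And>s t. bounded (rel s t)" and AB: "A \<in> sets" "B \<in> sets"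
  shows "{z. \<exists>a b. pair a z \<in> A \<and> pair b z \<in> B \<and> R a b} \<in> sets"
proof -
  let ?\<theta> = "bex ''s'' (Var ''a'') (bex ''t'' (Var ''a'')
    (Var ''a'' \<^bold>= pair_tm (Var ''s'') (Var ''t'') \<^bold>\<and> rel (Var ''s'') (Var ''t'') \<^bold>\<and>
     pair_tm (Var ''s'') (Var ''w'') \<^bold>\<in> ''A'' \<^bold>\<and> pair_tm (Var ''t'') (Var ''w'') \<^bold>\<in> ''B''))"
  have "bounded ?\<theta>"
    using assms(2) by (intro bounded_rules) simp_all
  then have "{p. \<exists>u z. p = pair u z \<and> (\<exists>a b. u = pair a b \<and> R a b \<and> pair a z \<in> A \<and> pair b z \<in> B)} \<in> sets"
    using pairs_in_sets[OF _ AB, of ?\<theta>] by (simp add: sat_bex assms(1) ex_le_pair)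
  from projection_in_sets[OF this] show ?thesis
    by (rule back_subst[of "\<lambda>X. X \<in> sets"]) auto
qed

text \<open>The value does not bound the arguments, as a product with zero shows. They are therefore
  packed into one component and projected away.\<close>

lemma operation_in_sets:
  assumes "\<And>e s t. tm_val M e (op s t) = f (tm_val M e s) (tm_val M e t)"
    and AB: "A \<in> sets" "B \<in> sets"
  shows "{p. \<exists>a b z. p = pair (f a b) z \<and> pair a z \<in> A \<and> pair b z \<in> B} \<in> sets"
proof -
  let ?\<theta> = "bex ''s'' (Var ''a'') (bex ''t'' (Var ''a'')
    (Var ''a'' \<^bold>= pair_tm (Var ''s'') (Var ''t'') \<^bold>\<and>
     bex ''u'' (Var ''w'') (bex ''v'' (Var ''w'')
      (Var ''w'' \<^bold>= pair_tm (Var ''u'') (Var ''v'') \<^bold>\<and> Var ''u'' \<^bold>= op (Var ''s'') (Var ''t'') \<^bold>\<and>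
       pair_tm (Var ''s'') (Var ''v'') \<^bold>\<in> ''A'' \<^bold>\<and> pair_tm (Var ''t'') (Var ''v'') \<^bold>\<in> ''B''))))"
  have "bounded ?\<theta>"
    by (intro bounded_rules) simp_all
  then have "{q. \<exists>u p. q = pair u p \<and> (\<exists>a b. u = pair a b \<and>
      (\<exists>v z. p = pair v z \<and> v = f a b \<and> pair a z \<in> A \<and> pair b z \<in> B))} \<in> sets"
    using pairs_in_sets[OF _ AB, of ?\<theta>] by (simp add: sat_bex assms(1) ex_le_pair)
  from projection_in_sets[OF this] show ?thesis
    by (rule back_subst[of "\<lambda>X. X \<in> sets"]) auto
qed

section \<open>Coded assignments, graphs of terms and truth sets\<close>

text \<open>
  \<open>decodes e xs z e'\<close> says that \<open>z\<close> codes the values that \<open>e'\<close> takes on the list \<open>xs\<close> and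
  that \<open>e'\<close> agrees with \<open>e\<close> elsewhere. If a variable is repeated in \<open>xs\<close>, its first occurrence
  determines the value, so that a quantifier may rebind a variable already in \<open>xs\<close>.
\<close>

primrec decodes :: "(name \<Rightarrow> 'a) \<Rightarrow> name list \<Rightarrow> 'a \<Rightarrow> (name \<Rightarrow> 'a) \<Rightarrow> bool" where
  "decodes e [] z e' \<longleftrightarrow> z = \<zero> \<and> e' = e"
| "decodes e (x # xs) z e' \<longleftrightarrow> (\<exists>a w d. z = pair a w \<and> decodes e xs w d \<and> e' = d(x := a))"

text \<open>Injectivity of pairing allows only one reading of a code. This makes negation a
  complement and conjunction an intersection of truth sets.\<close>

lemma decodes_unique: "decodes e xs z e1 \<Longrightarrow> decodes e xs z e2 \<Longrightarrow> e1 = e2"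
proof (induction xs arbitrary: z e1 e2)
  case (Cons x xs)
  then show ?case by (fastforce simp del: fun_upd_apply)
qed simp

definition codes :: "(name \<Rightarrow> 'a) \<Rightarrow> name list \<Rightarrow> 'a set" where
  "codes e xs = {z. \<exists>e'. decodes e xs z e'}"

text \<open>The value comes first because projection removes the first component.\<close>

definition graph :: "(name \<Rightarrow> 'a) \<Rightarrow> name list \<Rightarrow> tm \<Rightarrow> 'a set" where
  "graph e xs t = {p. \<exists>z e'. p = pair (tm_val M e' t) z \<and> decodes e xs z e'}"

definition truth :: "(name \<Rightarrow> 'a) \<Rightarrow> (name \<Rightarrow> 'a set) \<Rightarrow> name list \<Rightarrow> fm \<Rightarrow> 'a set" where
  "truth e E xs \<phi> = {z. \<exists>e'. decodes e xs z e' \<and> sat M e' E \<phi>}"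

lemma codes_in_sets: "codes e xs \<in> sets"
proof (induction xs)
  case Nil
  show ?case using singleton_in_sets[of \<zero>] by (simp add: codes_def)
next
  case (Cons x xs)
  have "{p. \<exists>a w. p = pair a w \<and> w \<in> codes e xs} \<in> sets"
    using pairs_in_sets[OF _ Cons Cons, of "Var ''w'' \<^bold>\<in> ''A''"] by (simp add: bounded.intros)
  then show ?case by (rule back_subst[of "\<lambda>X. X \<in> sets"]) (auto simp: codes_def)
qed

text \<open>If \<open>y\<close> heads the list, its value is the first component of the code and the
  rest is an arbitrary code; otherwise the value is read from the rest, and finally from
  \<open>e\<close>.\<close>

lemma graph_Var_in_sets: "graph e xs (Var y) \<in> sets"
proof (induction xs)
  case Nil
  show ?case using singleton_in_sets[of "pair (e y) \<zero>"] by (simp add: graph_def)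
next
  case (Cons x xs)
  show ?case
  proof (cases "x = y")
    case True
    let ?\<theta> = "bex ''v'' (Var ''w'') (Var ''w'' \<^bold>= pair_tm (Var ''a'') (Var ''v'') \<^bold>\<and> Var ''v'' \<^bold>\<in> ''A'')"
    have "{p. \<exists>a w. p = pair a w \<and> (\<exists>v. w = pair a v \<and> v \<in> codes e xs)} \<in> sets"
      using pairs_in_sets[OF _ codes_in_sets codes_in_sets, of ?\<theta>]
      by (simp add: bounded_rules sat_bex ex_le_pair)
    then show ?thesis
      by (rule back_subst[of "\<lambda>X. X \<in> sets"]) (auto simp: graph_def codes_def True, metis fun_upd_same)
  next
    case False
    let ?\<theta> = "bex ''u'' (Var ''w'') (bex ''v'' (Var ''w'')
      (Var ''w'' \<^bold>= pair_tm (Var ''u'') (Var ''v'') \<^bold>\<and> pair_tm (Var ''a'') (Var ''v'') \<^bold>\<in> ''A''))"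
    have "{p. \<exists>a w. p = pair a w \<and> (\<exists>u v. w = pair u v \<and> pair a v \<in> graph e xs (Var y))} \<in> sets"
      using pairs_in_sets[OF _ Cons Cons, of ?\<theta>] by (simp add: bounded_rules sat_bex ex_le_pair)
    then show ?thesis
      by (rule back_subst[of "\<lambda>X. X \<in> sets"]) (use False in \<open>auto simp: graph_def, metis fun_upd_other\<close>)
  qed
qed

lemma graph_in_sets: "graph e xs t \<in> sets"
proof (induction t)
  case (Var y)
  show ?case by (rule graph_Var_in_sets)
next
  case Zero
  have "{p. \<exists>a w. p = pair a w \<and> a = \<zero> \<and> w \<in> codes e xs} \<in> sets"
    using pairs_in_sets[OF _ codes_in_sets codes_in_sets, of "Var ''a'' \<^bold>= \<^bold>0 \<^bold>\<and> Var ''w'' \<^bold>\<in> ''A''"]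
    by (simp add: bounded.intros)
  then show ?case
    by (rule back_subst[of "\<lambda>X. X \<in> sets"]) (auto simp: graph_def codes_def)
next
  case One
  have "{p. \<exists>a w. p = pair a w \<and> a = \<one> \<and> w \<in> codes e xs} \<in> sets"
    using pairs_in_sets[OF _ codes_in_sets codes_in_sets, of "Var ''a'' \<^bold>= \<^bold>1 \<^bold>\<and> Var ''w'' \<^bold>\<in> ''A''"]
    by (simp add: bounded.intros)
  then show ?case
    by (rule back_subst[of "\<lambda>X. X \<in> sets"]) (auto simp: graph_def codes_def)
next
  case (Add s t)
  have "{p. \<exists>a b z. p = pair (a \<oplus> b) z \<and> pair a z \<in> graph e xs s \<and> pair b z \<in> graph e xs t} \<in> sets"
    by (rule operation_in_sets[of Add, OF tm_val.simps(4) Add])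
  then show ?case
    by (rule back_subst[of "\<lambda>X. X \<in> sets"]) (auto simp: graph_def dest: decodes_unique)
next
  case (Mul s t)
  have "{p. \<exists>a b z. p = pair (a \<otimes> b) z \<and> pair a z \<in> graph e xs s \<and> pair b z \<in> graph e xs t} \<in> sets"
    by (rule operation_in_sets[of Mul, OF tm_val.simps(5) Mul])
  then show ?case
    by (rule back_subst[of "\<lambda>X. X \<in> sets"]) (auto simp: graph_def dest: decodes_unique)
qed

lemma truth_Neg: "truth e E xs (\<^bold>\<not> \<phi>) = codes e xs - truth e E xs \<phi>"
  by (auto simp: truth_def codes_def dest: decodes_unique)

lemma truth_And: "truth e E xs (\<phi> \<^bold>\<and> \<psi>) = truth e E xs \<phi> \<inter> truth e E xs \<psi>"
  by (auto simp: truth_def dest: decodes_unique)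

lemma truth_Or: "truth e E xs (\<phi> \<^bold>\<or> \<psi>) = truth e E xs \<phi> \<union> truth e E xs \<psi>"
  by (auto simp: truth_def)

text \<open>Pushing \<open>x\<close> onto the list overrides any earlier value of \<open>x\<close>.
  The quantifier thus becomes a projection, the step that rests on closure extension.\<close>

lemma truth_ExN: "truth e E xs (\<^bold>\<exists>N x. \<phi>) = {w. \<exists>a. pair a w \<in> truth e E (x # xs) \<phi>}"
  by (auto simp: truth_def)

lemma truth_Imp: "truth e E xs (\<phi> \<^bold>\<rightarrow> \<psi>) = truth e E xs (\<^bold>\<not> \<phi> \<^bold>\<or> \<psi>)"
  by (auto simp: truth_def)

lemma truth_Iff:
  "truth e E xs (\<phi> \<^bold>\<leftrightarrow> \<psi>) = truth e E xs ((\<phi> \<^bold>\<and> \<psi>) \<^bold>\<or> (\<^bold>\<not> \<phi> \<^bold>\<and> \<^bold>\<not> \<psi>))"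
  by (auto simp: truth_def)

lemma truth_AllN: "truth e E xs (\<^bold>\<forall>N x. \<phi>) = truth e E xs (\<^bold>\<not> (\<^bold>\<exists>N x. \<^bold>\<not> \<phi>))"
  by (simp add: truth_def)

lemmas truth_simps = truth_Iff truth_Imp truth_AllN truth_Neg truth_And truth_Or truth_ExN

text \<open>The list stays arbitrary in the induction because a quantifier lengthens it. Atomic
  formulas reduce to graphs of terms, connectives to Boolean operations and quantifiers to
  projections.\<close>

lemma truth_in_sets:
  assumes "arithmetical \<phi>" and E: "range E \<subseteq> sets"
  shows "truth e E xs \<phi> \<in> sets"
  using assms(1)
proof (induction arbitrary: xs)
  case (1 s t)
  have "{z. \<exists>a b. pair a z \<in> graph e xs s \<and> pair b z \<in> graph e xs t \<and> a = b} \<in> sets"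
    by (rule relation_in_sets[of Eq]) (simp_all add: graph_in_sets bounded.intros)
  then show ?case
    by (rule back_subst[of "\<lambda>X. X \<in> sets"]) (auto simp: truth_def graph_def dest: decodes_unique)
next
  case (2 s t)
  have "{z. \<exists>a b. pair a z \<in> graph e xs s \<and> pair b z \<in> graph e xs t \<and> a \<prec> b} \<in> sets"
    by (rule relation_in_sets[of Less]) (simp_all add: graph_in_sets bounded.intros)
  then show ?case
    by (rule back_subst[of "\<lambda>X. X \<in> sets"]) (auto simp: truth_def graph_def dest: decodes_unique)
next
  case (3 t X)
  have "E X \<in> sets" using E by blast
  then have "{p. \<exists>a w. p = pair a w \<and> pair a w \<in> graph e xs t \<and> a \<in> E X} \<in> sets"
    using pairs_in_sets[OF _ graph_in_sets[of e xs t],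
        of "pair_tm (Var ''a'') (Var ''w'') \<^bold>\<in> ''A'' \<^bold>\<and> Var ''a'' \<^bold>\<in> ''B''" "E X"]
    by (simp add: bounded.intros)
  from projection_in_sets[OF this] show ?case
    by (rule back_subst[of "\<lambda>X. X \<in> sets"]) (auto simp: truth_def graph_def)
qed (simp_all only: truth_simps Diff_in_sets Int_in_sets Un_in_sets codes_in_sets projection_in_sets)

lemma arithmetical_comprehension:
  assumes "arithmetical \<phi>" and "range E \<subseteq> sets"
  shows "{a. sat M (e(x := a)) E \<phi>} \<in> sets"
proof -
  \<comment> \<open>The empty list is coded by \<open>\<zero>\<close>, so
    \<open>pair a \<zero>\<close> codes the assignment of \<open>a\<close> to \<open>x\<close>
    alone.\<close>
  have "{a. pair a \<zero> \<in> truth e E [x] \<phi>} \<in> sets"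
    using arith_comprehension[OF _ truth_in_sets[OF assms] empty_in_sets, of "pair_tm vx \<^bold>0 \<^bold>\<in> ''A''"]
    by (simp add: bounded.intros)
  then show ?thesis by (simp add: truth_def)
qed

lemma models_ACA0: "M \<Turnstile> ACA0"
  unfolding models_def
proof (intro ballI allI impI)
  fix \<phi> e and E :: "name \<Rightarrow> 'a set"
  assume "\<phi> \<in> ACA0" and E: "range E \<subseteq> sets"
  then consider "\<phi> \<in> basic_axioms" | "\<phi> = induction_fm ''n'' (Var ''n'' \<^bold>\<in> ''X'')"
    | X x \<psi> where "\<phi> = comprehension_fm X x \<psi>" "arithmetical \<psi>" "X \<notin> free_set \<psi>"
    unfolding ACA0_def by blast
  then show "sat M e E \<phi>"
  proof cases
    case 1
    then show ?thesis using sat_RCA0 E unfolding RCA0_def by blast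
  next
    case 2
    have "{a. a \<in> E ''X''} \<in> sets" using E by auto
    then show ?thesis unfolding 2 sat_induction_fm using set_induct[of "\<lambda>a. a \<in> E ''X''"] by auto
  next
    case 3
    then show ?thesis
      using arithmetical_comprehension[OF 3(2) E, of e x]
      by (auto simp: comprehension_fm_def sat_fun_upd_set)
  qed
qed

end

theorem theorem3p5:
  fixes M :: "'a l2_structure"
  assumes "M \<Turnstile> RCA0" and "M \<Turnstile> QF_CE"
  shows "M \<Turnstile> ACA0"
proof (cases "set_part M = {}")
  \<comment> \<open>There is no assignment of sets, so every axiom holds vacuously.\<close>
  case True
  then show ?thesis unfolding models_def by simp
next
  case False
  then interpret ce_model M using assms by unfold_locales
  show ?thesis by (rule models_ACA0)
qed

end
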